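(* Let $\Omega\subset\mathbb{R}^n$ be a domain and $s\in(0,1)$. Then $P_{n,s}^2(\Omega)>0$ if $\Omega$ satisfies one of the following criteria: (i) There exist $R>0$ and $c>0$ such that $|\Omega^c\cap B(x,R)|>c$ for each $x\in\Omega$. (ii) $\Omega$ is an LS($s$) type domain.
   Context: "Domain" means a nonempty open subset of $\mathbb{R}^n$ (not required to be connected). $|E|$ denotes Lebesgue measure, $B(x,R)$ the ball of radius $R$ centered at $x$, $\Omega^c=\mathbb{R}^n\setminus\Omega$. For an open set $\Omega\subset\mathbb{R}^n$ and $s\in(0,1)$, $H^s_\Omega(\mathbb{R}^n)$ is the closure of $C_c^\infty(\Omega)$ (functions extended by zero to $\mathbb{R}^n$) with respect to the norm $$\|u\|_{H^s(\mathbb{R}^n)}=\|u\|_{L^2(\Omega)}+\left(\int_{\mathbb{R}^n}\int_{\mathbb{R}^n}\frac{(u(x)-u(y))^2}{|x-y|^{n+2s}}\,dx\,dy\right)^{1/2},$$ and (the superscript 2 is a label, not a power) $$P_{n,s}^2(\Omega)=\inf_{u\in H^s_\Omega(\mathbb{R}^n),\,u\neq0}\frac{\int_{\mathbb{R}^n}\int_{\mathbb{R}^n}\frac{(u(x)-u(y))^2}{|x-y|^{n+2s}}\,dx\,dy}{\int_\Omega u^2},$$ with the convention $P^2_{n,s}(\emptyset)=+\infty$ (infimum over the empty set). Uniform FP($s$): FP($s$) is said to hold uniformly for a family $\{\Omega_\alpha\}_{\alpha\in\mathbb{A}}$ of open sets in $\mathbb{R}^n$ if $\inf_{\alpha}P_{n,s}^2(\Omega_\alpha)>0$.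 For $\omega\in S^{n-1}$ (the unit sphere of $\mathbb{R}^n$) and $x_0\in\mathbb{R}^n$, let $L_\Omega(x_0,\omega)=\{t\in\mathbb{R} : x_0+t\omega\in\Omega\}\subset\mathbb{R}$. $\Omega$ is of type LS($s$) if there exists a set $\sigma\subset S^{n-1}$ of positive $(n-1)$-dimensional Hausdorff measure such that the one-dimensional FP($s$) inequality holds uniformly for the family $\{L_\Omega(x_0,\omega)\}_{x_0\in\mathbb{R}^n,\ \omega\in\sigma}$, i.e. $\inf_{x_0\in\mathbb{R}^n,\,\omega\in\sigma}P_{1,s}^2(L_\Omega(x_0,\omega))>0$. *)

theory Defs
  imports "HOL-Analysis.Analysis"
begin

text \<open>
  The ambient space is an arbitrary Euclidean space \<open>'a\<close>, so that \<open>n = DIM('a)\<close>; one-dimensional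
  objects live on the type \<^typ>\<open>real\<close>.
\<close>

text \<open>\<open>C\<^sup>k\<close> on the whole space: the derivative of a \<open>C\<^bsup>k+1\<^esup>\<close> function is \<open>C\<^sup>k\<close>, tested on each direction.\<close>

primrec C_k :: "nat \<Rightarrow> ('a::euclidean_space \<Rightarrow> real) \<Rightarrow> bool" where
  "C_k 0 f \<longleftrightarrow> continuous_on UNIV f"
| "C_k (Suc k) f \<longleftrightarrow> f differentiable_on UNIV \<and> (\<forall>v. C_k k (\<lambda>x. frechet_derivative f (at x) v))"

definition Cc_infinity :: "'a::euclidean_space set \<Rightarrow> ('a \<Rightarrow> real) set" where
  "Cc_infinity \<Omega> =
     {f. (\<forall>k. C_k k f) \<and> compact (closure {x. f x \<noteq> 0}) \<and> closure {x. f x \<noteq> 0} \<subseteq> \<Omega>}"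

text \<open>On the diagonal the integrand is \<open>0 / 0 = 0\<close>.\<close>

definition gagliardo_energy :: "real \<Rightarrow> ('a::euclidean_space \<Rightarrow> real) \<Rightarrow> ennreal" where
  "gagliardo_energy s u =
     (\<integral>\<^sup>+y. (\<integral>\<^sup>+x. ennreal ((u x - u y)\<^sup>2 / norm (x - y) powr (real DIM('a) + 2 * s)) \<partial>lborel) \<partial>lborel)"

definition L2_energy :: "'a::euclidean_space set \<Rightarrow> ('a \<Rightarrow> real) \<Rightarrow> ennreal" where
  "L2_energy \<Omega> u = (\<integral>\<^sup>+x\<in>\<Omega>. ennreal ((u x)\<^sup>2) \<partial>lborel)"

text \<open>
  The functions on \<open>\<Omega>\<close>, extended by zero, whose \<open>H\<^sup>s\<close> norm is finite. Functions are not
  identified almost everywhere; every class has a Borel representative vanishing off \<open>\<Omega>\<close>.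
\<close>

definition Hs_ambient :: "real \<Rightarrow> 'a::euclidean_space set \<Rightarrow> ('a \<Rightarrow> real) set" where
  "Hs_ambient s \<Omega> =
     {u. u \<in> borel_measurable borel \<and> (\<forall>x. x \<notin> \<Omega> \<longrightarrow> u x = 0) \<and>
         L2_energy \<Omega> u < \<infinity> \<and> gagliardo_energy s u < \<infinity>}"

text \<open>Only meaningful on \<^const>\<open>Hs_ambient\<close>, since \<^const>\<open>enn2real\<close> sends \<open>\<infinity>\<close> to 0.\<close>

definition Hs_norm :: "real \<Rightarrow> 'a::euclidean_space set \<Rightarrow> ('a \<Rightarrow> real) \<Rightarrow> real" where
  "Hs_norm s \<Omega> u = sqrt (enn2real (L2_energy \<Omega> u)) + sqrt (enn2real (gagliardo_energy s u))"

definition Hs_space :: "real \<Rightarrow> 'a::euclidean_space set \<Rightarrow> ('a \<Rightarrow> real) set" where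
  "Hs_space s \<Omega> =
     {u \<in> Hs_ambient s \<Omega>. \<forall>\<epsilon>>0. \<exists>\<phi> \<in> Cc_infinity \<Omega>. Hs_norm s \<Omega> (\<lambda>x. u x - \<phi> x) < \<epsilon>}"

text \<open>
  \<open>P\<^sup>2\<^bsub>n,s\<^esub>(\<Omega>)\<close> with \<open>n = DIM('a)\<close>; the superscript is a label. The condition \<open>u \<noteq> 0\<close> is read
  almost everywhere, so the denominator is never 0. For \<open>\<Omega> = {}\<close> the infimum is over the empty
  set and equals \<open>\<infinity>\<close>.
\<close>

definition P2 :: "real \<Rightarrow> 'a::euclidean_space set \<Rightarrow> ennreal" where
  "P2 s \<Omega> =
     (INF u \<in> {u \<in> Hs_space s \<Omega>. \<not> (AE x in lborel. u x = 0)}. gagliardo_energy s u / L2_energy \<Omega> u)"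

definition uniform_FP :: "real \<Rightarrow> 'i set \<Rightarrow> ('i \<Rightarrow> 'a::euclidean_space set) \<Rightarrow> bool" where
  "uniform_FP s A \<Omega> \<longleftrightarrow> (INF \<alpha>\<in>A. P2 s (\<Omega> \<alpha>)) > 0"

text \<open>
  The \<open>d\<close>-dimensional Hausdorff (outer) measure, with the usual normalization. The empty set has
  weight 0 also for \<open>d = 0\<close>, where every other set has weight 1, giving the counting measure.
  Covering sets must be bounded because \<^const>\<open>diameter\<close> is unspecified on unbounded sets.
\<close>

definition hausdorff_weight :: "nat \<Rightarrow> 'a::metric_space set \<Rightarrow> ennreal" where
  "hausdorff_weight d U =
     (if U = {} then 0 else ennreal (unit_ball_vol (real d) * (diameter U / 2) ^ d))"

definition hausdorff_measure :: "nat \<Rightarrow> 'a::metric_space set \<Rightarrow> ennreal" where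
  "hausdorff_measure d E =
     (SUP \<delta>\<in>{0<..}.
        INF U \<in> {U :: nat \<Rightarrow> 'a set. E \<subseteq> (\<Union>i. U i) \<and> (\<forall>i. bounded (U i) \<and> diameter (U i) \<le> \<delta>)}.
          (\<Sum>i. hausdorff_weight d (U i)))"

definition line_section :: "'a::euclidean_space set \<Rightarrow> 'a \<Rightarrow> 'a \<Rightarrow> real set" where
  "line_section \<Omega> x0 \<omega> = {t. x0 + t *\<^sub>R \<omega> \<in> \<Omega>}"

definition LS_type :: "real \<Rightarrow> 'a::euclidean_space set \<Rightarrow> bool" where
  "LS_type s \<Omega> \<longleftrightarrow>
     (\<exists>\<sigma> \<subseteq> sphere 0 1. hausdorff_measure (DIM('a) - 1) \<sigma> > 0 \<and>
        uniform_FP s (UNIV \<times> \<sigma>) (\<lambda>(x0, \<omega>). line_section \<Omega> x0 \<omega>))"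

end

theory Submission
  imports Defs
begin

text \<open>
  It suffices to bound the Gagliardo energy of every \<open>u\<close> in \<^const>\<open>Hs_space\<close> below by a positive
  multiple of its \<open>L\<^sup>2\<close> energy.

  If the complement of \<open>\<Omega>\<close> has measure at least \<open>c\<close> in every ball of radius \<open>R\<close> about a point of
  \<open>\<Omega>\<close>, this is immediate: in the double integral it is enough to keep the pairs of a point
  \<open>y \<in> \<Omega>\<close> and a point \<open>x \<notin> \<Omega>\<close> at distance less than \<open>R\<close>, for which the numerator is \<open>(u y)\<^sup>2\<close>
  (\<open>gagliardo_energy_ge_complement\<close>).

  If \<open>\<Omega>\<close> is of LS type, the energy is compared with one-dimensional energies. For a vector \<open>k\<close>, the
  energies of \<open>u\<close> along all lines parallel to \<open>k\<close> add up to a directional energy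
  (\<open>directional_energy_over_lines\<close>), and the directional energies for \<open>1 \<le> norm k \<le> 2\<close> integrate to
  a constant multiple of the full energy (\<open>shell_integral_directional_energy\<close>); this replaces polar
  coordinates by a linear change of variables. The uniform one-dimensional inequality bounds the
  directional energy below for every direction in \<open>\<sigma>\<close>, hence on the truncated cone over \<open>\<sigma>\<close>. This
  cone may fail to be measurable, but the set of all good \<open>k\<close> is Borel and contains it, and its
  measure is bounded below because \<open>\<sigma>\<close> has positive Hausdorff measure
  (\<open>cone_outer_measure_positive\<close>).

  The one-dimensional inequality is available only for functions on the line that are limits of
  test functions, which for a general \<open>u\<close> would have to be established line by line. The estimate
  is therefore proved for test functions, whose restrictions to lines are again test functions, and
  extended by density (\<open>energy_bound_extends_to_Hs_space\<close>). The density argument needs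
  that test functions have finite energy (\<open>gagliardo_energy_Cc_infinity_finite\<close>).
\<close>

section \<open>Energy along a direction\<close>

lemma nn_integral_lborel_translate:
  fixes f :: "'a::euclidean_space \<Rightarrow> ennreal"
  assumes [measurable]: "f \<in> borel_measurable borel"
  shows "(\<integral>\<^sup>+x. f (a + x) \<partial>lborel) = (\<integral>\<^sup>+x. f x \<partial>lborel)"
proof -
  have "(\<integral>\<^sup>+x. f x \<partial>lborel) = (\<integral>\<^sup>+x. f x \<partial>distr lborel borel ((+) a))"
    by (simp add: lborel_distr_plus)
  also have "\<dots> = (\<integral>\<^sup>+x. f (a + x) \<partial>lborel)"
    by (rule nn_integral_distr) auto
  finally show ?thesis by simp
qed

lemma nn_integral_lborel_dilate:
  fixes f :: "'a::euclidean_space \<Rightarrow> ennreal"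
  assumes [measurable]: "f \<in> borel_measurable borel" and "c \<noteq> 0"
  shows "(\<integral>\<^sup>+x. f x \<partial>lborel) = ennreal (\<bar>c\<bar> ^ DIM('a)) * (\<integral>\<^sup>+x. f (c *\<^sub>R x) \<partial>lborel)"
  by (subst lborel_affine[OF \<open>c \<noteq> 0\<close>, of 0])
     (simp add: nn_integral_density nn_integral_distr nn_integral_cmult)

definition increment_energy :: "('a::euclidean_space \<Rightarrow> real) \<Rightarrow> 'a \<Rightarrow> ennreal" where
  "increment_energy u h = (\<integral>\<^sup>+x. ennreal ((u (x + h) - u x)\<^sup>2) \<partial>lborel)"

text \<open>
  For a unit vector \<open>k\<close> this is the one-dimensional Gagliardo energy of \<open>u\<close> on the lines parallel to
  \<open>k\<close>, integrated over all these lines: one variable of the double integral on a line and the choice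
  of the line together make up the integral over the whole space in \<^const>\<open>increment_energy\<close>.
\<close>

definition directional_energy :: "real \<Rightarrow> ('a::euclidean_space \<Rightarrow> real) \<Rightarrow> 'a \<Rightarrow> ennreal" where
  "directional_energy s u k =
     (\<integral>\<^sup>+t. increment_energy u (t *\<^sub>R k) * ennreal (\<bar>t\<bar> powr - (1 + 2 * s)) \<partial>lborel)"

lemma borel_measurable_increment_energy [measurable]:
  assumes [measurable]: "u \<in> borel_measurable borel"
  shows "increment_energy u \<in> borel_measurable borel"
  unfolding increment_energy_def[abs_def] by measurable

lemma borel_measurable_directional_energy [measurable]:
  assumes [measurable]: "u \<in> borel_measurable borel"
  shows "directional_energy s u \<in> borel_measurable borel"
  unfolding directional_energy_def[abs_def] by measurable

lemma gagliardo_energy_eq_increments: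
  fixes u :: "'a::euclidean_space \<Rightarrow> real"
  assumes [measurable]: "u \<in> borel_measurable borel"
  shows "gagliardo_energy s u =
    (\<integral>\<^sup>+h. increment_energy u h * ennreal (norm h powr - (real DIM('a) + 2 * s)) \<partial>lborel)"
proof -
  define p where "p = real DIM('a) + 2 * s"
  let ?w = "\<lambda>h::'a. ennreal (norm h powr - p)"
  have "gagliardo_energy s u =
     (\<integral>\<^sup>+y. (\<integral>\<^sup>+x. ennreal ((u x - u y)\<^sup>2) * ?w (x - y) \<partial>lborel) \<partial>lborel)"
    unfolding gagliardo_energy_def p_def[symmetric]
    by (intro nn_integral_cong) (simp add: powr_minus divide_inverse ennreal_mult')
  also have "\<dots> = (\<integral>\<^sup>+y. (\<integral>\<^sup>+h. ennreal ((u (y + h) - u y)\<^sup>2) * ?w h \<partial>lborel) \<partial>lborel)"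
  proof (rule nn_integral_cong)
    fix y :: 'a
    show "(\<integral>\<^sup>+x. ennreal ((u x - u y)\<^sup>2) * ?w (x - y) \<partial>lborel) =
          (\<integral>\<^sup>+h. ennreal ((u (y + h) - u y)\<^sup>2) * ?w h \<partial>lborel)"
      by (subst nn_integral_lborel_translate[of _ y, symmetric]) simp_all
  qed
  also have "\<dots> = (\<integral>\<^sup>+h. (\<integral>\<^sup>+y. ennreal ((u (y + h) - u y)\<^sup>2) * ?w h \<partial>lborel) \<partial>lborel)"
    by (rule lborel_pair.Fubini') measurable
  also have "\<dots> = (\<integral>\<^sup>+h. increment_energy u h * ?w h \<partial>lborel)"
    unfolding increment_energy_def by (intro nn_integral_cong nn_integral_multc) measurable
  finally show ?thesis by (simp add: p_def)
qed

text \<open>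
  Every line in direction \<open>\<omega>\<close> meets the slab \<open>0 \<le> x \<bullet> \<omega> < 1\<close> in a segment of length one. Inserting
  this unit length as an extra integral and translating by \<open>\<tau> *\<^sub>R \<omega>\<close> gives Fubini's theorem for an
  arbitrary direction without a rotation or an orthogonal complement: each line is counted from all
  its points in the slab, with total weight one.
\<close>

lemma nn_integral_over_parallel_lines:
  fixes f :: "'a::euclidean_space \<Rightarrow> ennreal" and \<omega> :: 'a
  assumes [measurable]: "f \<in> borel_measurable borel" and "norm \<omega> = 1"
  shows "(\<integral>\<^sup>+x. f x \<partial>lborel) =
    (\<integral>\<^sup>+x. indicator {x. x \<bullet> \<omega> \<in> {0..<1}} x * (\<integral>\<^sup>+\<tau>. f (x + \<tau> *\<^sub>R \<omega>) \<partial>lborel) \<partial>lborel)"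
proof -
  define slab :: "'a \<Rightarrow> ennreal" where "slab = (\<lambda>x. indicator {0..<1} (x \<bullet> \<omega>))"
  have [measurable]: "slab \<in> borel_measurable borel" unfolding slab_def by measurable
  have one: "\<omega> \<bullet> \<omega> = 1" using \<open>norm \<omega> = 1\<close> by (simp add: dot_square_norm)
  have unit: "(\<integral>\<^sup>+\<tau>. slab (x - \<tau> *\<^sub>R \<omega>) \<partial>lborel) = 1" for x
  proof -
    have "slab (x - \<tau> *\<^sub>R \<omega>) = indicator {x \<bullet> \<omega> - 1<..x \<bullet> \<omega>} \<tau>" for \<tau>
      unfolding slab_def by (auto simp: indicator_def inner_diff_left one)
    then show ?thesis by simp
  qed
  have "(\<integral>\<^sup>+x. f x \<partial>lborel) = (\<integral>\<^sup>+x. (\<integral>\<^sup>+\<tau>. f x * slab (x - \<tau> *\<^sub>R \<omega>) \<partial>lborel) \<partial>lborel)"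
    by (simp add: nn_integral_cmult unit)
  also have "\<dots> = (\<integral>\<^sup>+\<tau>. (\<integral>\<^sup>+x. f x * slab (x - \<tau> *\<^sub>R \<omega>) \<partial>lborel) \<partial>lborel)"
    by (rule lborel_pair.Fubini') measurable
  also have "\<dots> = (\<integral>\<^sup>+\<tau>. (\<integral>\<^sup>+x. f (x + \<tau> *\<^sub>R \<omega>) * slab x \<partial>lborel) \<partial>lborel)"
  proof (rule nn_integral_cong)
    fix \<tau> :: real
    show "(\<integral>\<^sup>+x. f x * slab (x - \<tau> *\<^sub>R \<omega>) \<partial>lborel) = (\<integral>\<^sup>+x. f (x + \<tau> *\<^sub>R \<omega>) * slab x \<partial>lborel)"
      by (subst nn_integral_lborel_translate[of _ "\<tau> *\<^sub>R \<omega>", symmetric]) (simp_all add: add.commute)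
  qed
  also have "\<dots> = (\<integral>\<^sup>+x. (\<integral>\<^sup>+\<tau>. f (x + \<tau> *\<^sub>R \<omega>) * slab x \<partial>lborel) \<partial>lborel)"
    by (rule lborel_pair.Fubini') measurable
  also have "\<dots> = (\<integral>\<^sup>+x. slab x * (\<integral>\<^sup>+\<tau>. f (x + \<tau> *\<^sub>R \<omega>) \<partial>lborel) \<partial>lborel)"
    by (intro nn_integral_cong) (subst nn_integral_multc, simp_all add: mult.commute)
  finally show ?thesis by (simp add: slab_def indicator_def)
qed

text \<open>
  This is how a hypothesis about one-dimensional sections enters: the directional energy is an
  average of genuine one-dimensional Gagliardo energies.
\<close>

lemma directional_energy_over_lines:
  fixes u :: "'a::euclidean_space \<Rightarrow> real" and \<omega> :: 'a
  assumes [measurable]: "u \<in> borel_measurable borel" and \<omega>: "norm \<omega> = 1"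
  shows "directional_energy s u \<omega> =
    (\<integral>\<^sup>+x. indicator {x. x \<bullet> \<omega> \<in> {0..<1}} x * gagliardo_energy s (\<lambda>\<tau>. u (x + \<tau> *\<^sub>R \<omega>)) \<partial>lborel)"
proof -
  define slab :: "'a \<Rightarrow> ennreal" where "slab = indicator {x. x \<bullet> \<omega> \<in> {0..<1}}"
  have [measurable]: "slab \<in> borel_measurable borel" unfolding slab_def by measurable
  let ?w = "\<lambda>t. ennreal (\<bar>t\<bar> powr - (1 + 2 * s))"
  have incr: "increment_energy u (t *\<^sub>R \<omega>) =
      (\<integral>\<^sup>+x. slab x * increment_energy (\<lambda>\<tau>. u (x + \<tau> *\<^sub>R \<omega>)) t \<partial>lborel)" for t
    unfolding increment_energy_def slab_def
    by (subst nn_integral_over_parallel_lines[OF _ \<omega>]) (simp_all add: scaleR_add_left add.assoc)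
  have "directional_energy s u \<omega> =
      (\<integral>\<^sup>+t. (\<integral>\<^sup>+x. slab x * increment_energy (\<lambda>\<tau>. u (x + \<tau> *\<^sub>R \<omega>)) t * ?w t \<partial>lborel) \<partial>lborel)"
    unfolding directional_energy_def incr
    by (intro nn_integral_cong nn_integral_multc[symmetric])
       (unfold increment_energy_def, measurable)
  also have "\<dots> =
      (\<integral>\<^sup>+x. (\<integral>\<^sup>+t. slab x * increment_energy (\<lambda>\<tau>. u (x + \<tau> *\<^sub>R \<omega>)) t * ?w t \<partial>lborel) \<partial>lborel)"
    unfolding increment_energy_def by (rule lborel_pair.Fubini') measurable
  also have "\<dots> = (\<integral>\<^sup>+x. slab x * gagliardo_energy s (\<lambda>\<tau>. u (x + \<tau> *\<^sub>R \<omega>)) \<partial>lborel)"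
    by (intro nn_integral_cong)
       (simp add: gagliardo_energy_eq_increments mult.assoc nn_integral_cmult)
  finally show ?thesis by (simp add: slab_def)
qed

lemma directional_energy_scaleR:
  fixes u :: "'a::euclidean_space \<Rightarrow> real"
  assumes [measurable]: "u \<in> borel_measurable borel" and "r > 0"
  shows "directional_energy s u (r *\<^sub>R k) = ennreal (r powr (2 * s)) * directional_energy s u k"
proof -
  have eq: "ennreal r * (increment_energy u ((r * t) *\<^sub>R k) * ennreal (\<bar>r * t\<bar> powr - (1 + 2 * s))) =
     ennreal (r powr (- 2 * s)) * (increment_energy u (t *\<^sub>R r *\<^sub>R k) * ennreal (\<bar>t\<bar> powr - (1 + 2 * s)))" for t
  proof -
    have "r * \<bar>r * t\<bar> powr - (1 + 2 * s) = r powr (- 2 * s) * \<bar>t\<bar> powr - (1 + 2 * s)"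
      using \<open>r > 0\<close> by (simp add: abs_mult powr_mult powr_minus powr_add powr_diff field_simps)
    then have "ennreal r * ennreal (\<bar>r * t\<bar> powr - (1 + 2 * s)) =
        ennreal (r powr (- 2 * s)) * ennreal (\<bar>t\<bar> powr - (1 + 2 * s))"
      using \<open>r > 0\<close> by (simp flip: ennreal_mult)
    then have "increment_energy u ((r * t) *\<^sub>R k) * (ennreal r * ennreal (\<bar>r * t\<bar> powr - (1 + 2 * s))) =
        increment_energy u ((t * r) *\<^sub>R k) * (ennreal (r powr (- 2 * s)) * ennreal (\<bar>t\<bar> powr - (1 + 2 * s)))"
      by (simp only: mult.commute[of r t])
    then show ?thesis
      unfolding scaleR_scaleR by (simp only: mult_ac)
  qed
  have "directional_energy s u k = ennreal r *
      (\<integral>\<^sup>+t. increment_energy u ((r * t) *\<^sub>R k) * ennreal (\<bar>r * t\<bar> powr - (1 + 2 * s)) \<partial>lborel)"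
    unfolding directional_energy_def using \<open>r > 0\<close>
    by (subst nn_integral_lborel_dilate[of _ r]) simp_all
  also have "\<dots> = ennreal (r powr (- 2 * s)) * directional_energy s u (r *\<^sub>R k)"
    unfolding directional_energy_def
    by (subst (1 2) nn_integral_cmult[symmetric]) (simp_all only: eq, measurable)
  finally have "ennreal (r powr (2 * s)) * directional_energy s u k =
      ennreal (r powr (2 * s) * r powr (- 2 * s)) * directional_energy s u (r *\<^sub>R k)"
    by (simp add: ennreal_mult mult.assoc)
  then show ?thesis using \<open>r > 0\<close> by (simp flip: powr_add)
qed

section \<open>Averaging the directional energy over a shell\<close>

text \<open>
  The substitution \<open>h = t *\<^sub>R k\<close> replaces polar coordinates. For fixed \<open>h\<close>, the \<open>t\<close> for which
  \<open>k = (1 / t) *\<^sub>R h\<close> lies in the shell \<open>1 \<le> norm k \<le> 2\<close> satisfy \<open>norm h / 2 \<le> \<bar>t\<bar> \<le> norm h\<close>. The kernel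
  \<open>\<bar>t\<bar> powr - (1 + 2 * s)\<close> together with the Jacobian \<open>\<bar>t\<bar> powr - n\<close> then integrates over these \<open>t\<close>
  to a multiple of the \<open>n\<close>-dimensional kernel \<open>norm h powr - (n + 2 * s)\<close>, the factor being the
  following value for \<open>norm h = 1\<close>.
\<close>

definition shell_constant :: "'a::euclidean_space itself \<Rightarrow> real \<Rightarrow> ennreal" where
  "shell_constant _ s =
     (\<integral>\<^sup>+t. indicator {1..2} (1 / \<bar>t\<bar>) * ennreal (\<bar>t\<bar> powr - (real DIM('a) + 1 + 2 * s)) \<partial>lborel)"

lemma shell_constant_finite:
  assumes "s > 0"
  shows "shell_constant TYPE('a::euclidean_space) s < \<infinity>"
proof -
  define p where "p = real DIM('a) + 1 + 2 * s"
  have "p > 0" using assms by (simp add: p_def)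
  have "shell_constant TYPE('a) s \<le> (\<integral>\<^sup>+t. ennreal (2 powr p) * indicator {-1..1::real} t \<partial>lborel)"
    unfolding shell_constant_def p_def[symmetric]
  proof (rule nn_integral_mono)
    fix t :: real
    show "indicator {1..2} (1 / \<bar>t\<bar>) * ennreal (\<bar>t\<bar> powr - p) \<le> ennreal (2 powr p) * indicator {-1..1} t"
    proof (cases "1 / \<bar>t\<bar> \<in> {1..2}")
      case True
      then have "t \<noteq> 0" by auto
      with True have t: "\<bar>t\<bar> \<le> 1" by (auto simp: field_simps)
      have "\<bar>t\<bar> powr - p = (1 / \<bar>t\<bar>) powr p"
        by (simp add: powr_minus powr_divide inverse_eq_divide)
      also have "\<dots> \<le> 2 powr p"
        using True \<open>p > 0\<close> by (intro powr_mono2) auto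
      finally show ?thesis using True t by (auto simp: indicator_def intro: ennreal_leI)
    qed simp
  qed
  also have "\<dots> < \<infinity>" by (subst nn_integral_cmult) (auto simp: ennreal_mult_less_top)
  finally show ?thesis .
qed

lemma shell_constant_positive:
  assumes "s > 0"
  shows "shell_constant TYPE('a::euclidean_space) s > 0"
proof -
  define p where "p = real DIM('a) + 1 + 2 * s"
  have "p > 0" using assms by (simp add: p_def)
  have "ennreal (1 / 2) = (\<integral>\<^sup>+t. indicator {1/2..1::real} t \<partial>lborel)"
    by simp
  also have "\<dots> \<le> shell_constant TYPE('a) s"
    unfolding shell_constant_def p_def[symmetric]
  proof (rule nn_integral_mono)
    fix t :: real
    show "indicator {1/2..1} t \<le> indicator {1..2} (1 / \<bar>t\<bar>) * ennreal (\<bar>t\<bar> powr - p)"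
    proof (cases "t \<in> {1/2..1}")
      case True
      then have "t powr - p \<ge> 1 powr - p" using \<open>p > 0\<close> by (intro powr_mono2') auto
      moreover have "1 / t \<in> {1..2}" using True by (auto simp: field_simps)
      ultimately show ?thesis using True by (auto simp: indicator_def)
    qed simp
  qed
  finally show ?thesis by (metis ennreal_less_zero_iff half_gt_zero less_le_trans zero_less_one)
qed

text \<open>
  Tonelli and scaling, as described above. It is used in both directions: to bound the energy of a
  function below by its directional energies, and to see that smooth functions have finite energy.
\<close>

lemma shell_integral_directional_energy:
  fixes u :: "'a::euclidean_space \<Rightarrow> real"
  assumes [measurable]: "u \<in> borel_measurable borel"
  shows "(\<integral>\<^sup>+k. indicator {1..2} (norm k) * directional_energy s u k \<partial>lborel) =
    shell_constant TYPE('a) s * gagliardo_energy s u"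
proof -
  define p where "p = real DIM('a) + 1 + 2 * s"
  let ?w = "\<lambda>t. ennreal (\<bar>t\<bar> powr - (1 + 2 * s))"
  let ?\<psi> = "indicator {1..2} :: real \<Rightarrow> ennreal"
  have scale: "(\<integral>\<^sup>+k. ?\<psi> (norm k) * increment_energy u (t *\<^sub>R k) * ?w t \<partial>lborel) =
      (\<integral>\<^sup>+h. ?\<psi> (norm h / \<bar>t\<bar>) * ennreal (\<bar>t\<bar> powr - p) * increment_energy u h \<partial>lborel)" for t :: real
  \<comment> \<open>At \<open>t = 0\<close> both sides vanish since \<open>0 powr a = 0\<close>.\<close>
  proof (cases "t = 0")
    case False
    have w: "ennreal (\<bar>t\<bar> powr - (1 + 2 * s)) = ennreal (\<bar>t\<bar> ^ DIM('a)) * ennreal (\<bar>t\<bar> powr - p)"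
      using False by (simp add: p_def powr_realpow[symmetric] powr_add[symmetric] flip: ennreal_mult)
    have "(\<integral>\<^sup>+h. ?\<psi> (norm h / \<bar>t\<bar>) * ennreal (\<bar>t\<bar> powr - p) * increment_energy u h \<partial>lborel) =
        ennreal (\<bar>t\<bar> ^ DIM('a)) *
        (\<integral>\<^sup>+k. ?\<psi> (norm k) * ennreal (\<bar>t\<bar> powr - p) * increment_energy u (t *\<^sub>R k) \<partial>lborel)"
      using False by (subst nn_integral_lborel_dilate[of _ t]) simp_all
    also have "\<dots> = (\<integral>\<^sup>+k. ?\<psi> (norm k) * increment_energy u (t *\<^sub>R k) * ?w t \<partial>lborel)"
      unfolding w by (subst nn_integral_cmult[symmetric]) (simp_all add: mult_ac)
    finally show ?thesis by simp
  qed simp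
  have inner: "(\<integral>\<^sup>+t. ?\<psi> (norm h / \<bar>t\<bar>) * ennreal (\<bar>t\<bar> powr - p) * increment_energy u h \<partial>lborel) =
      shell_constant TYPE('a) s *
      (increment_energy u h * ennreal (norm h powr - (real DIM('a) + 2 * s)))" for h :: 'a
  proof (cases "h = 0")
    case True
    then show ?thesis by (simp add: increment_energy_def)
  next
    case False
    then have r: "norm h > 0" by simp
    have "(\<integral>\<^sup>+t. ?\<psi> (norm h / \<bar>t\<bar>) * ennreal (\<bar>t\<bar> powr - p) \<partial>lborel) =
        ennreal (norm h) * (\<integral>\<^sup>+t. ?\<psi> (1 / \<bar>t\<bar>) * ennreal (\<bar>norm h * t\<bar> powr - p) \<partial>lborel)"
      using r by (subst nn_integral_lborel_dilate[of _ "norm h"]) (simp_all add: abs_mult)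
    also have "\<dots> = (\<integral>\<^sup>+t. ennreal (norm h powr - (real DIM('a) + 2 * s)) *
          (?\<psi> (1 / \<bar>t\<bar>) * ennreal (\<bar>t\<bar> powr - p)) \<partial>lborel)"
    proof (subst nn_integral_cmult[symmetric])
      have "ennreal (norm h) * ennreal (\<bar>norm h * t\<bar> powr - p) =
          ennreal (norm h powr - (real DIM('a) + 2 * s)) * ennreal (\<bar>t\<bar> powr - p)" for t
      proof -
        have "norm h * norm h powr - p = norm h powr (1 + - p)"
          using r by (simp add: powr_add del: add_uminus_conv_diff)
        then have "norm h * \<bar>norm h * t\<bar> powr - p = norm h powr - (real DIM('a) + 2 * s) * \<bar>t\<bar> powr - p"
          using r by (simp add: abs_mult powr_mult p_def flip: mult.assoc)
        then show ?thesis by (simp flip: ennreal_mult)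
      qed
      then show "(\<integral>\<^sup>+t. ennreal (norm h) * (?\<psi> (1 / \<bar>t\<bar>) * ennreal (\<bar>norm h * t\<bar> powr - p)) \<partial>lborel) =
        (\<integral>\<^sup>+t. ennreal (norm h powr - (real DIM('a) + 2 * s)) * (?\<psi> (1 / \<bar>t\<bar>) * ennreal (\<bar>t\<bar> powr - p)) \<partial>lborel)"
        by (simp only: mult.left_commute[of _ "?\<psi> _"])
    qed measurable
    also have "\<dots> = ennreal (norm h powr - (real DIM('a) + 2 * s)) * shell_constant TYPE('a) s"
      unfolding shell_constant_def p_def by (rule nn_integral_cmult) measurable
    finally show ?thesis
      by (subst nn_integral_multc) (simp_all add: mult_ac)
  qed
  have "(\<integral>\<^sup>+k. ?\<psi> (norm k) * directional_energy s u k \<partial>lborel) =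
      (\<integral>\<^sup>+k. (\<integral>\<^sup>+t. ?\<psi> (norm k) * increment_energy u (t *\<^sub>R k) * ?w t \<partial>lborel) \<partial>lborel)"
    unfolding directional_energy_def
    by (intro nn_integral_cong) (simp add: mult.assoc nn_integral_cmult)
  also have "\<dots> = (\<integral>\<^sup>+t. (\<integral>\<^sup>+k. ?\<psi> (norm k) * increment_energy u (t *\<^sub>R k) * ?w t \<partial>lborel) \<partial>lborel)"
    by (rule lborel_pair.Fubini') measurable
  also have "\<dots> = (\<integral>\<^sup>+t. (\<integral>\<^sup>+h. ?\<psi> (norm h / \<bar>t\<bar>) * ennreal (\<bar>t\<bar> powr - p) * increment_energy u h \<partial>lborel) \<partial>lborel)"
    by (simp only: scale)
  also have "\<dots> = (\<integral>\<^sup>+h. (\<integral>\<^sup>+t. ?\<psi> (norm h / \<bar>t\<bar>) * ennreal (\<bar>t\<bar> powr - p) * increment_energy u h \<partial>lborel) \<partial>lborel)"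
    by (rule lborel_pair.Fubini') measurable
  also have "\<dots> = (\<integral>\<^sup>+h. shell_constant TYPE('a) s *
      (increment_energy u h * ennreal (norm h powr - (real DIM('a) + 2 * s))) \<partial>lborel)"
    by (simp only: inner)
  also have "\<dots> = shell_constant TYPE('a) s * gagliardo_energy s u"
    unfolding gagliardo_energy_eq_increments[OF assms] by (rule nn_integral_cmult) measurable
  finally show ?thesis .
qed

section \<open>Test functions\<close>

text \<open>
  The factor \<open>t\<^sup>2\<close> makes the kernel integrable at 0 because \<open>s < 1\<close>, and at infinity it is integrable
  because \<open>s > 0\<close>.
\<close>

lemma truncated_kernel_integral_finite:
  assumes "0 < s" "s < 1"
  shows "(\<integral>\<^sup>+t. ennreal (min 1 (t\<^sup>2) * \<bar>t\<bar> powr - (1 + 2 * s)) \<partial>lborel) < \<infinity>"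
proof -
  let ?f = "\<lambda>t::real. ennreal (t powr (1 - 2 * s)) * indicator {0..1} t"
  let ?g = "\<lambda>t::real. ennreal (t powr - (1 + 2 * s)) * indicator {1..} t"
  have "(\<lambda>t::real. t powr (1 - 2 * s)) integrable_on {0..1}"
    using assms by (intro integrable_on_powr_from_0) auto
  then have "integral\<^sup>N lborel ?f = ennreal (integral {0..1} (\<lambda>t. t powr (1 - 2 * s)))"
    by (intro nn_integral_has_integral_lebesgue') (auto simp: has_integral_integral)
  then have f: "integral\<^sup>N lborel ?f < \<infinity>" by simp
  have "integral\<^sup>N lborel ?g = ennreal (- (1 powr (- (1 + 2 * s) + 1)) / (- (1 + 2 * s) + 1))"
    using assms by (intro nn_integral_has_integral_lebesgue' has_integral_powr_to_inf) auto
  then have g: "integral\<^sup>N lborel ?g < \<infinity>" by simp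
  have reflect: "integral\<^sup>N lborel q = (\<integral>\<^sup>+t. q (- t) \<partial>lborel)"
    if [measurable]: "q \<in> borel_measurable borel" for q :: "real \<Rightarrow> ennreal"
    by (subst nn_integral_lborel_dilate[of _ "-1"]) simp_all
  have "(\<integral>\<^sup>+t. ennreal (min 1 (t\<^sup>2) * \<bar>t\<bar> powr - (1 + 2 * s)) \<partial>lborel)
      \<le> (\<integral>\<^sup>+t. (?f t + ?g t) + (?f (- t) + ?g (- t)) \<partial>lborel)"
  proof (rule nn_integral_mono)
    fix t :: real
    have *: "ennreal (min 1 (t\<^sup>2) * t powr - (1 + 2 * s)) \<le> ?f t + ?g t" if "t \<ge> 0" for t :: real
    proof -
      consider "t = 0" | "t > 0" "t < 1" | "t \<ge> 1" using \<open>t \<ge> 0\<close> by linarith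
      then show ?thesis
      proof cases
        case 2
        have "t\<^sup>2 * t powr - (1 + 2 * s) = t powr (2 + - (1 + 2 * s))"
          using 2 by (simp only: powr_add) simp
        moreover have "min 1 (t\<^sup>2) * t powr - (1 + 2 * s) \<le> t\<^sup>2 * t powr - (1 + 2 * s)"
          by (intro mult_right_mono) auto
        ultimately have "min 1 (t\<^sup>2) * t powr - (1 + 2 * s) \<le> t powr (1 - 2 * s)"
          by simp
        then show ?thesis using 2 by (auto simp: indicator_def intro: ennreal_leI)
      next
        case 3
        then show ?thesis by (auto simp: indicator_def min_def)
      qed simp
    qed
    show "ennreal (min 1 (t\<^sup>2) * \<bar>t\<bar> powr - (1 + 2 * s)) \<le> (?f t + ?g t) + (?f (- t) + ?g (- t))"
    proof (cases "t \<ge> 0")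
      case True
      then show ?thesis using *[of t] by (simp add: add_increasing2)
    next
      case False
      then show ?thesis using *[of "- t"] by (simp add: add_increasing)
    qed
  qed
  also have "\<dots> = (integral\<^sup>N lborel ?f + integral\<^sup>N lborel ?g) + (integral\<^sup>N lborel ?f + integral\<^sup>N lborel ?g)"
    using reflect[of ?f] reflect[of ?g] by (simp add: nn_integral_add)
  also have "\<dots> < \<infinity>" using f g by simp
  finally show ?thesis .
qed

lemma C_k_along_line:
  fixes f :: "'a::euclidean_space \<Rightarrow> real"
  assumes "C_k k f"
  shows "C_k k (\<lambda>t::real. f (x + t *\<^sub>R \<omega>))"
  using assms
proof (induction k arbitrary: f)
  case 0
  then have "continuous_on UNIV f" by simp
  then have "continuous_on UNIV (\<lambda>t::real. f (x + t *\<^sub>R \<omega>))"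
    by (rule continuous_on_compose2) (auto intro!: continuous_intros)
  then show ?case by simp
next
  case (Suc k)
  have deriv: "((\<lambda>t::real. f (x + t *\<^sub>R \<omega>)) has_derivative
      (\<lambda>v. frechet_derivative f (at (x + t *\<^sub>R \<omega>)) (v *\<^sub>R \<omega>))) (at t)" for t
  proof -
    have "f differentiable (at (x + t *\<^sub>R \<omega>))"
      using Suc.prems by (simp add: differentiable_on_def)
    then have "(f has_derivative frechet_derivative f (at (x + t *\<^sub>R \<omega>))) (at (x + t *\<^sub>R \<omega>))"
      by (simp add: frechet_derivative_works)
    moreover have "((\<lambda>t::real. x + t *\<^sub>R \<omega>) has_derivative (\<lambda>v. v *\<^sub>R \<omega>)) (at t)"
      by (auto intro!: derivative_eq_intros)
    ultimately show ?thesis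
      by (rule has_derivative_compose[rotated])
  qed
  have "frechet_derivative (\<lambda>t::real. f (x + t *\<^sub>R \<omega>)) (at t) v =
      frechet_derivative f (at (x + t *\<^sub>R \<omega>)) (v *\<^sub>R \<omega>)" for t v
    using frechet_derivative_at[OF deriv] by metis
  moreover have "C_k k (\<lambda>t. frechet_derivative f (at (x + t *\<^sub>R \<omega>)) (v *\<^sub>R \<omega>))" for v
    using Suc.IH[of "\<lambda>y. frechet_derivative f (at y) (v *\<^sub>R \<omega>)"] Suc.prems by simp
  moreover have "(\<lambda>t::real. f (x + t *\<^sub>R \<omega>)) differentiable_on UNIV"
    unfolding differentiable_on_def differentiable_def using deriv by blast
  ultimately show ?case by simp
qed

lemma Cc_infinity_along_line:
  fixes \<phi> :: "'a::euclidean_space \<Rightarrow> real"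
  assumes \<phi>: "\<phi> \<in> Cc_infinity \<Omega>" and \<omega>: "norm \<omega> = 1"
  shows "(\<lambda>t. \<phi> (x + t *\<^sub>R \<omega>)) \<in> Cc_infinity (line_section \<Omega> x \<omega>)"
proof -
  define K where "K = closure {x. \<phi> x \<noteq> 0}"
  have K: "compact K" "K \<subseteq> \<Omega>" and smooth: "C_k k \<phi>" for k
    using \<phi> by (auto simp: Cc_infinity_def K_def)
  define L where "L = (\<lambda>t. x + t *\<^sub>R \<omega>) -` K"
  have "closed L"
    unfolding L_def using K(1)
    by (intro closed_vimage compact_imp_closed continuous_intros)
  have sub: "closure {t. \<phi> (x + t *\<^sub>R \<omega>) \<noteq> 0} \<subseteq> L"
    using closure_subset[of "{x. \<phi> x \<noteq> 0}"]
    by (intro closure_minimal \<open>closed L\<close>) (auto simp: L_def K_def)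
  obtain B where B: "\<And>y. y \<in> K \<Longrightarrow> norm y \<le> B"
    using compact_imp_bounded[OF K(1)] by (auto simp: bounded_iff)
  have "norm t \<le> B + norm x" if "t \<in> L" for t
  proof -
    have "norm t = norm ((x + t *\<^sub>R \<omega>) - x)" using \<omega> by simp
    also have "\<dots> \<le> norm (x + t *\<^sub>R \<omega>) + norm x" by (rule norm_triangle_ineq4)
    also have "\<dots> \<le> B + norm x" using that B by (simp add: L_def)
    finally show ?thesis .
  qed
  then have "bounded L" unfolding bounded_iff by blast
  then have "compact (closure {t. \<phi> (x + t *\<^sub>R \<omega>) \<noteq> 0})"
    using sub by (meson bounded_subset closed_closure compact_eq_bounded_closed)
  moreover have "L \<subseteq> line_section \<Omega> x \<omega>"
    using K(2) by (auto simp: L_def line_section_def)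
  ultimately show ?thesis
    using sub C_k_along_line[OF smooth] by (auto simp: Cc_infinity_def)
qed

lemma borel_measurable_Cc_infinity:
  assumes "\<phi> \<in> Cc_infinity \<Omega>"
  shows "\<phi> \<in> borel_measurable borel"
proof -
  have "C_k 0 \<phi>" using assms unfolding Cc_infinity_def by blast
  then show ?thesis by (intro borel_measurable_continuous_onI) simp
qed

lemma Cc_infinity_eq_0_outside:
  assumes "\<phi> \<in> Cc_infinity \<Omega>" "x \<notin> \<Omega>"
  shows "\<phi> x = 0"
  using assms closure_subset[of "{x. \<phi> x \<noteq> 0}"] by (auto simp: Cc_infinity_def)

lemma Cc_infinity_Lipschitz:
  fixes \<phi> :: "'a::euclidean_space \<Rightarrow> real"
  assumes \<phi>: "\<phi> \<in> Cc_infinity \<Omega>"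
  obtains L where "\<And>x y. \<bar>\<phi> x - \<phi> y\<bar> \<le> L * norm (x - y)"
proof -
  let ?D = "\<lambda>x. frechet_derivative \<phi> (at x)"
  define K where "K = closure {x. \<phi> x \<noteq> 0}"
  have K: "compact K" and "C_k (Suc 0) \<phi>"
    using \<phi> unfolding Cc_infinity_def K_def by blast+
  then have diff: "\<phi> differentiable (at x)" and cont: "continuous_on UNIV (\<lambda>x. ?D x v)" for x v
    by (simp_all add: differentiable_on_def)
  have vanish: "?D x v = 0" if "x \<notin> K" for x v
  proof -
    have "?D x = frechet_derivative (\<lambda>_. 0) (at x)"
      using that closure_subset[of "{x. \<phi> x \<noteq> 0}"]
      by (intro frechet_derivative_transform_within_open[OF diff, of "- K"])
         (auto simp: K_def)
    then show ?thesis by simp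
  qed
  have "\<exists>B\<ge>0. \<forall>x. \<bar>?D x v\<bar> \<le> B" for v
  proof -
    have "compact ((\<lambda>x. ?D x v) ` K)"
      using K cont by (intro compact_continuous_image) (auto intro: continuous_on_subset)
    then obtain B where "\<And>x. x \<in> K \<Longrightarrow> \<bar>?D x v\<bar> \<le> B"
      using compact_imp_bounded[of "(\<lambda>x. ?D x v) ` K"] by (auto simp: bounded_iff)
    then have "\<bar>?D x v\<bar> \<le> max 0 B" for x
      by (cases "x \<in> K") (auto simp: vanish le_max_iff_disj)
    then show ?thesis by (meson max.cobounded1)
  qed
  then obtain B where B0: "\<And>v. B v \<ge> 0" and B: "\<And>v x. \<bar>?D x v\<bar> \<le> B v" by metis
  define L where "L = (\<Sum>b\<in>Basis. B b)"
  have "norm (\<phi> x - \<phi> y) \<le> L * norm (x - y)" for x y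
  proof (rule differentiable_bound[of UNIV \<phi> ?D])
    fix x
    show "(\<phi> has_derivative ?D x) (at x)" using diff by (simp add: frechet_derivative_works)
    have lin: "linear (?D x)" by (rule linear_frechet_derivative[OF diff])
    show "onorm (?D x) \<le> L"
    proof (rule onorm_bound)
      show "0 \<le> L" unfolding L_def by (intro sum_nonneg B0)
      fix v :: 'a
      have "?D x v = ?D x (\<Sum>b\<in>Basis. (v \<bullet> b) *\<^sub>R b)" by (simp add: euclidean_representation)
      also have "\<dots> = (\<Sum>b\<in>Basis. (v \<bullet> b) * ?D x b)"
        using lin by (simp add: linear_sum linear_cmul)
      finally have "norm (?D x v) \<le> (\<Sum>b\<in>Basis. \<bar>v \<bullet> b\<bar> * \<bar>?D x b\<bar>)"
        by (simp add: sum_abs[THEN order_trans] abs_mult)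
      also have "\<dots> \<le> (\<Sum>b\<in>Basis. norm v * B b)"
        by (intro sum_mono mult_mono B) (auto simp: Basis_le_norm)
      also have "\<dots> = L * norm v" by (simp add: L_def sum_distrib_left mult.commute)
      finally show "norm (?D x v) \<le> L * norm v" .
    qed
  qed auto
  then show ?thesis using that by auto
qed

text \<open>
  The increment of \<open>\<phi>\<close> by \<open>h\<close> is at most a multiple of \<open>min 1 (norm h)\<close>, by boundedness and the
  Lipschitz bound, and it vanishes unless \<open>x\<close> or \<open>x + h\<close> lies in the support of \<open>\<phi>\<close>. Such \<open>x\<close> form a
  set of at most twice the measure of the support, whatever \<open>h\<close> is.
\<close>

lemma increment_energy_Cc_infinity_le:
  fixes \<phi> :: "'a::euclidean_space \<Rightarrow> real"
  assumes \<phi>: "\<phi> \<in> Cc_infinity \<Omega>"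
  obtains A where "A \<ge> 0" "\<And>h. increment_energy \<phi> h \<le> ennreal (A * min 1 ((norm h)\<^sup>2))"
proof -
  obtain L where L: "\<And>x y. \<bar>\<phi> x - \<phi> y\<bar> \<le> L * norm (x - y)"
    using Cc_infinity_Lipschitz[OF \<phi>] by blast
  define K where "K = closure {x. \<phi> x \<noteq> 0}"
  have K: "compact K" and "C_k 0 \<phi>"
    using \<phi> unfolding Cc_infinity_def K_def by blast+
  have outside: "\<phi> x = 0" if "x \<notin> K" for x
    using that closure_subset[of "{x. \<phi> x \<noteq> 0}"] by (auto simp: K_def)
  have "compact (\<phi> ` K)"
    using K \<open>C_k 0 \<phi>\<close> by (intro compact_continuous_image) (auto intro: continuous_on_subset)
  then obtain M where "\<And>x. x \<in> K \<Longrightarrow> \<bar>\<phi> x\<bar> \<le> M"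
    using compact_imp_bounded[of "\<phi> ` K"] by (auto simp: bounded_iff)
  then have M: "\<bar>\<phi> x\<bar> \<le> max 0 M" for x
    by (cases "x \<in> K") (auto simp: outside le_max_iff_disj)
  define C where "C = max (L\<^sup>2) ((2 * max 0 M)\<^sup>2)"
  have pointwise: "(\<phi> (x + h) - \<phi> x)\<^sup>2 \<le> C * min 1 ((norm h)\<^sup>2)" for x h
  proof -
    have "\<bar>\<phi> (x + h) - \<phi> x\<bar> \<le> L * norm h" using L[of "x + h" x] by simp
    then have "\<bar>\<phi> (x + h) - \<phi> x\<bar>\<^sup>2 \<le> (L * norm h)\<^sup>2" by (intro power_mono) auto
    also have "\<dots> \<le> C * (norm h)\<^sup>2"
      unfolding power_mult_distrib C_def by (intro mult_right_mono) auto
    finally have 1: "(\<phi> (x + h) - \<phi> x)\<^sup>2 \<le> C * (norm h)\<^sup>2" by simp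
    have "\<bar>\<phi> (x + h) - \<phi> x\<bar> \<le> 2 * max 0 M" using M[of x] M[of "x + h"] by linarith
    then have "\<bar>\<phi> (x + h) - \<phi> x\<bar>\<^sup>2 \<le> (2 * max 0 M)\<^sup>2" by (intro power_mono) auto
    also have "\<dots> \<le> C" by (simp add: C_def)
    finally have "(\<phi> (x + h) - \<phi> x)\<^sup>2 \<le> C" by simp
    with 1 show ?thesis by (simp add: min_def)
  qed
  have Kb[measurable]: "K \<in> sets borel" using K by (intro borel_closed compact_imp_closed)
  have fin: "emeasure lborel K < \<infinity>" using K by (intro emeasure_compact_finite)
  define A where "A = 2 * C * measure lborel K"
  have "C \<ge> 0" by (simp add: C_def le_max_iff_disj)
  have "increment_energy \<phi> h \<le> ennreal (A * min 1 ((norm h)\<^sup>2))" for h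
  proof -
    let ?c = "ennreal (C * min 1 ((norm h)\<^sup>2))"
    have "increment_energy \<phi> h \<le> (\<integral>\<^sup>+x. ?c * (indicator K (h + x) + indicator K x) \<partial>lborel)"
      unfolding increment_energy_def
    proof (rule nn_integral_mono)
      fix x
      show "ennreal ((\<phi> (x + h) - \<phi> x)\<^sup>2) \<le> ?c * (indicator K (h + x) + indicator K x)"
      proof (cases "x \<in> K \<or> h + x \<in> K")
        case True
        then have "?c * 1 \<le> ?c * (indicator K (h + x) + indicator K x)"
          by (intro mult_left_mono) (auto simp: indicator_def)
        then show ?thesis using ennreal_leI[OF pointwise[of x h]] by simp
      next
        case False
        then show ?thesis by (simp add: outside add.commute[of x h])
      qed
    qed
    also have "\<dots> = ?c * (emeasure lborel K + emeasure lborel K)"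
      using nn_integral_lborel_translate[of "indicator K" h]
      by (simp add: nn_integral_cmult nn_integral_add)
    also have "\<dots> = ennreal (A * min 1 ((norm h)\<^sup>2))"
      using fin \<open>C \<ge> 0\<close> by (simp add: A_def emeasure_eq_ennreal_measure mult_ac flip: ennreal_mult ennreal_plus)
    finally show ?thesis .
  qed
  moreover have "A \<ge> 0" using \<open>C \<ge> 0\<close> by (simp add: A_def)
  ultimately show ?thesis using that by blast
qed

text \<open>
  By the shell identity it suffices to bound the directional energies uniformly on the shell, which
  is the one-dimensional computation for the truncated kernel.
\<close>

lemma gagliardo_energy_Cc_infinity_finite:
  fixes \<phi> :: "'a::euclidean_space \<Rightarrow> real"
  assumes \<phi>: "\<phi> \<in> Cc_infinity \<Omega>" and s: "0 < s" "s < 1"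
  shows "gagliardo_energy s \<phi> < \<infinity>"
proof -
  have [measurable]: "\<phi> \<in> borel_measurable borel" by (rule borel_measurable_Cc_infinity[OF \<phi>])
  obtain A where "A \<ge> 0" and A: "\<And>h. increment_energy \<phi> h \<le> ennreal (A * min 1 ((norm h)\<^sup>2))"
    using increment_energy_Cc_infinity_le[OF \<phi>] by blast
  define J where "J = (\<integral>\<^sup>+t. ennreal (min 1 (t\<^sup>2) * \<bar>t\<bar> powr - (1 + 2 * s)) \<partial>lborel)"
  have J: "J < \<infinity>" unfolding J_def by (rule truncated_kernel_integral_finite[OF s])
  have bound: "directional_energy s \<phi> k \<le> ennreal (4 * A) * J" if k: "norm k \<le> 2" for k
  proof -
    have "directional_energy s \<phi> k \<le>
        (\<integral>\<^sup>+t. ennreal (4 * A) * ennreal (min 1 (t\<^sup>2) * \<bar>t\<bar> powr - (1 + 2 * s)) \<partial>lborel)"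
      unfolding directional_energy_def
    proof (rule nn_integral_mono)
      fix t :: real
      have "(norm (t *\<^sub>R k))\<^sup>2 \<le> (2 * \<bar>t\<bar>)\<^sup>2"
        using k mult_left_mono[OF k, of "\<bar>t\<bar>"] by (intro power_mono) (auto simp: mult.commute)
      then have "min 1 ((norm (t *\<^sub>R k))\<^sup>2) \<le> 4 * min 1 (t\<^sup>2)"
        by (auto simp: power_mult_distrib min_def)
      then have "A * min 1 ((norm (t *\<^sub>R k))\<^sup>2) \<le> 4 * A * min 1 (t\<^sup>2)"
        using \<open>A \<ge> 0\<close> mult_left_mono by fastforce
      then have "increment_energy \<phi> (t *\<^sub>R k) \<le> ennreal (4 * A * min 1 (t\<^sup>2))"
        using A[of "t *\<^sub>R k"] by (meson ennreal_leI order_trans)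
      then have "increment_energy \<phi> (t *\<^sub>R k) * ennreal (\<bar>t\<bar> powr - (1 + 2 * s)) \<le>
          ennreal (4 * A * min 1 (t\<^sup>2)) * ennreal (\<bar>t\<bar> powr - (1 + 2 * s))"
        by (rule mult_right_mono) simp
      also have "\<dots> = ennreal (4 * A) * ennreal (min 1 (t\<^sup>2) * \<bar>t\<bar> powr - (1 + 2 * s))"
        using \<open>A \<ge> 0\<close> by (simp add: mult.assoc flip: ennreal_mult)
      finally show "increment_energy \<phi> (t *\<^sub>R k) * ennreal (\<bar>t\<bar> powr - (1 + 2 * s)) \<le>
          ennreal (4 * A) * ennreal (min 1 (t\<^sup>2) * \<bar>t\<bar> powr - (1 + 2 * s))" .
    qed
    also have "\<dots> = ennreal (4 * A) * J" unfolding J_def by (rule nn_integral_cmult) measurable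
    finally show ?thesis .
  qed
  have "shell_constant TYPE('a) s * gagliardo_energy s \<phi> =
      (\<integral>\<^sup>+k. indicator {1..2} (norm k) * directional_energy s \<phi> k \<partial>lborel)"
    by (rule shell_integral_directional_energy[symmetric]) measurable
  also have "\<dots> \<le> (\<integral>\<^sup>+k. ennreal (4 * A) * J * indicator (cball 0 2) (k::'a) \<partial>lborel)"
    by (intro nn_integral_mono) (auto simp: indicator_def bound)
  also have "\<dots> = ennreal (4 * A) * J * emeasure lborel (cball 0 2 :: 'a set)"
    by (rule nn_integral_cmult_indicator) simp
  also have "\<dots> < \<infinity>"
    using J emeasure_lborel_cball_finite[of "0::'a" 2] by (simp add: ennreal_mult_less_top)
  finally show ?thesis
    using shell_constant_positive[OF s(1), where 'a='a] by (auto simp: ennreal_mult_less_top)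
qed

lemma L2_energy_eq:
  fixes u :: "'a::euclidean_space \<Rightarrow> real"
  assumes "\<And>x. x \<notin> \<Omega> \<Longrightarrow> u x = 0"
  shows "L2_energy \<Omega> u = (\<integral>\<^sup>+x. ennreal ((u x)\<^sup>2) \<partial>lborel)"
  unfolding L2_energy_def using assms by (intro nn_integral_cong) (auto simp: indicator_def)

lemma L2_energy_Cc_infinity_finite:
  fixes \<phi> :: "'a::euclidean_space \<Rightarrow> real"
  assumes \<phi>: "\<phi> \<in> Cc_infinity \<Omega>"
  shows "L2_energy \<Omega> \<phi> < \<infinity>"
proof -
  define K where "K = closure {x. \<phi> x \<noteq> 0}"
  have K: "compact K" and "C_k 0 \<phi>"
    using \<phi> unfolding Cc_infinity_def K_def by blast+
  have "compact (\<phi> ` K)"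
    using K \<open>C_k 0 \<phi>\<close> by (intro compact_continuous_image) (auto intro: continuous_on_subset)
  then obtain M where M: "\<And>x. x \<in> K \<Longrightarrow> \<bar>\<phi> x\<bar> \<le> M"
    using compact_imp_bounded[of "\<phi> ` K"] by (auto simp: bounded_iff)
  have outside: "\<phi> x = 0" if "x \<notin> K" for x
    using that closure_subset[of "{x. \<phi> x \<noteq> 0}"] by (auto simp: K_def)
  have "(\<phi> x)\<^sup>2 \<le> M\<^sup>2" if "x \<in> K" for x
    using power_mono[OF M[OF that], of 2] by simp
  then have "L2_energy \<Omega> \<phi> \<le> (\<integral>\<^sup>+x. ennreal (M\<^sup>2) * indicator K x \<partial>lborel)"
    unfolding L2_energy_def
    by (intro nn_integral_mono) (auto simp: indicator_def outside intro: ennreal_leI)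
  also have "\<dots> = ennreal (M\<^sup>2) * emeasure lborel K"
    using K by (intro nn_integral_cmult_indicator) (simp add: borel_compact)
  also have "\<dots> < \<infinity>"
    using emeasure_compact_finite[OF K] by (simp add: ennreal_mult_less_top)
  finally show ?thesis .
qed

lemma Cc_infinity_subset_Hs_space:
  fixes \<phi> :: "'a::euclidean_space \<Rightarrow> real"
  assumes \<phi>: "\<phi> \<in> Cc_infinity \<Omega>" and s: "0 < s" "s < 1"
  shows "\<phi> \<in> Hs_space s \<Omega>"
proof -
  have "\<phi> \<in> Hs_ambient s \<Omega>"
    unfolding Hs_ambient_def
    using borel_measurable_Cc_infinity[OF \<phi>] Cc_infinity_eq_0_outside[OF \<phi>]
      L2_energy_Cc_infinity_finite[OF \<phi>] gagliardo_energy_Cc_infinity_finite[OF \<phi> s] by auto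
  moreover have "Hs_norm s \<Omega> (\<lambda>x. \<phi> x - \<phi> x) = 0"
    by (simp add: Hs_norm_def L2_energy_def gagliardo_energy_def)
  ultimately show ?thesis unfolding Hs_space_def using \<phi> by (auto intro!: bexI[of _ \<phi>])
qed

section \<open>Cones over sets of positive Hausdorff measure\<close>

text \<open>
  Non-overlapping dyadic cubes inside an open neighbourhood of small measure; for cubes, the
  \<open>n\<close>-th power of the diameter is comparable to the volume. The gauge keeps each cube inside the neighbourhood and
  its diameter below \<open>\<delta>\<close>.
\<close>

lemma cover_by_small_cubes:
  fixes S :: "'a::euclidean_space set"
  assumes "bounded S" "S \<subseteq> B" "B \<in> sets borel" "emeasure lborel B < ennreal \<epsilon>" "\<epsilon> > 0" "\<delta> > 0"
  obtains K :: "nat \<Rightarrow> 'a set"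
  where "\<And>i. compact (K i)" "S \<subseteq> (\<Union>i. K i)" "\<And>i. diameter (K i) \<le> \<delta>"
    "(\<Sum>i. ennreal (diameter (K i) ^ DIM('a))) \<le> ennreal (2 * real DIM('a) ^ DIM('a) * \<epsilon>)"
proof -
  let ?n = "DIM('a)"
  obtain U where U: "open U" "B \<subseteq> U" and diff: "emeasure lborel (U - B) < ennreal \<epsilon>"
    using outer_regular_lborel[OF \<open>B \<in> sets borel\<close> \<open>\<epsilon> > 0\<close>] by blast
  have "emeasure lborel U = emeasure lborel (B \<union> (U - B))"
    using U by (intro arg_cong[where f = "emeasure lborel"]) auto
  also have "\<dots> \<le> emeasure lborel B + emeasure lborel (U - B)"
    using assms(3) U by (intro emeasure_subadditive) auto
  also have "\<dots> \<le> ennreal \<epsilon> + ennreal \<epsilon>"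
    using assms(4) diff by (intro add_mono) auto
  finally have U_small: "emeasure lborel U \<le> ennreal (2 * \<epsilon>)"
    using \<open>\<epsilon> > 0\<close> by (simp flip: ennreal_plus)
  obtain c where "c > 0" and c: "S \<subseteq> cbox (- c *\<^sub>R One) (c *\<^sub>R One)"
  proof -
    obtain b where b: "\<And>x. x \<in> S \<Longrightarrow> norm x \<le> b" using \<open>bounded S\<close> bounded_iff by blast
    have "S \<subseteq> cbox (- (\<bar>b\<bar> + 1) *\<^sub>R One) ((\<bar>b\<bar> + 1) *\<^sub>R One)"
    proof
      fix x assume "x \<in> S"
      then have "\<bar>x \<bullet> i\<bar> \<le> \<bar>b\<bar> + 1" if "i \<in> Basis" for i
        using b[of x] Basis_le_norm[OF that, of x] by linarith
      then show "x \<in> cbox (- (\<bar>b\<bar> + 1) *\<^sub>R One) ((\<bar>b\<bar> + 1) *\<^sub>R One)"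
        by (auto simp: mem_box abs_le_iff) (smt (verit))
    qed
    then show ?thesis using that[of "\<bar>b\<bar> + 1"] by auto
  qed
  have box: "box (- c *\<^sub>R One) (c *\<^sub>R One :: 'a) \<noteq> {}"
    using \<open>c > 0\<close> by (simp add: box_eq_empty)
  define g where "g x = (if x \<in> U then U else UNIV) \<inter> ball x (\<delta> / 2)" for x
  have "gauge g" unfolding gauge_def g_def using U \<open>\<delta> > 0\<close> by auto
  obtain \<D> where "countable \<D>"
     and cbox: "\<And>Q. Q \<in> \<D> \<Longrightarrow> interior Q \<noteq> {} \<and> (\<exists>a b. Q = cbox a b)"
     and disj: "pairwise (\<lambda>A B. interior A \<inter> interior B = {}) \<D>"
     and fine: "\<And>Q. Q \<in> \<D> \<Longrightarrow> \<exists>x \<in> S \<inter> Q. Q \<subseteq> g x"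
     and cube: "\<And>u v. cbox u v \<in> \<D> \<Longrightarrow>
        \<exists>n. \<forall>i \<in> Basis. v \<bullet> i - u \<bullet> i = ((c *\<^sub>R One) \<bullet> i - (- c *\<^sub>R One) \<bullet> i) / 2^n"
     and cover: "S \<subseteq> \<Union>\<D>"
    by (rule covering_lemma[OF c box \<open>gauge g\<close>]) blast
  have compact: "compact Q" if "Q \<in> \<D>" for Q using cbox[OF that] by auto
  have sub_U: "Q \<subseteq> U" and small: "diameter Q \<le> \<delta>" if Q: "Q \<in> \<D>" for Q
  proof -
    obtain x where x: "x \<in> S \<inter> Q" "Q \<subseteq> g x" using fine[OF Q] by blast
    have "x \<in> U" using x(1) assms(2) U(2) by blast
    then show "Q \<subseteq> U" using x(2) by (auto simp: g_def)
    have "diameter Q \<le> diameter (ball x (\<delta> / 2))"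
      using x by (intro diameter_subset) (auto simp: g_def)
    then show "diameter Q \<le> \<delta>" using \<open>\<delta> > 0\<close> by simp
  qed
  have vol: "ennreal (diameter Q ^ ?n) \<le> ennreal (real ?n ^ ?n) * emeasure lborel (interior Q)"
    if Q: "Q \<in> \<D>" for Q
  proof -
    obtain u v where uv: "Q = cbox u v" using cbox[OF Q] by blast
    then obtain k where k: "\<forall>i\<in>Basis. v \<bullet> i - u \<bullet> i = ((c *\<^sub>R One) \<bullet> i - (- c *\<^sub>R One) \<bullet> i) / 2^k"
      using cube[of u v] Q by blast
    define l where "l = 2 * c / 2 ^ k"
    have side: "(v - u) \<bullet> i = l" if "i \<in> Basis" for i
      using k that by (simp add: inner_diff_left l_def)
    have "l > 0" using \<open>c > 0\<close> by (simp add: l_def)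
    have le: "u \<bullet> i \<le> v \<bullet> i" if "i \<in> Basis" for i
      using side[OF that] \<open>l > 0\<close> by (simp add: inner_diff_left)
    have "diameter Q = norm (v - u)"
      using le by (simp add: uv diameter_cbox dist_norm norm_minus_commute)
    also have "\<dots> \<le> (\<Sum>i\<in>Basis. \<bar>(v - u) \<bullet> i\<bar>)" by (rule norm_le_l1)
    also have "\<dots> = real ?n * l"
      using \<open>l > 0\<close> by (simp add: side)
    finally have "diameter Q ^ ?n \<le> (real ?n * l) ^ ?n"
      by (intro power_mono diameter_ge_0 compact_imp_bounded compact[OF Q])
    moreover have "emeasure lborel (interior Q) = ennreal (l ^ ?n)"
      unfolding uv interior_cbox using le by (subst emeasure_lborel_box) (auto simp: side)
    ultimately show ?thesis
      using \<open>l > 0\<close> by (simp add: power_mult_distrib ennreal_leI flip: ennreal_mult)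
  qed
  \<comment> \<open>The cubes are enumerated without repetition, padding with empty sets if there are finitely
    many, so that summing over the enumeration counts every cube once.\<close>
  define K where "K i = (if i \<in> to_nat_on \<D> ` \<D> then from_nat_into \<D> i else {})" for i
  have K_cases: "K i = {} \<or> K i \<in> \<D> \<and> to_nat_on \<D> (K i) = i" for i
    using \<open>countable \<D>\<close> by (auto simp: K_def)
  have "disjoint_family (\<lambda>i. interior (K i))"
    unfolding disjoint_family_on_def
  proof (intro ballI impI)
    fix i j :: nat
    assume "i \<noteq> j"
    then show "interior (K i) \<inter> interior (K j) = {}"
      using K_cases[of i] K_cases[of j] disj by (fastforce simp: pairwise_def)
  qed
  then have "(\<Sum>i. emeasure lborel (interior (K i))) = emeasure lborel (\<Union>i. interior (K i))"
    by (intro suminf_emeasure) auto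
  also have "\<dots> \<le> emeasure lborel U"
  proof (intro emeasure_mono UN_least)
    show "interior (K i) \<subseteq> U" for i
      using K_cases[of i] sub_U[of "K i"] interior_subset[of "K i"] by auto
  qed (use U in simp)
  finally have total: "(\<Sum>i. emeasure lborel (interior (K i))) \<le> ennreal (2 * \<epsilon>)"
    using U_small by simp
  show ?thesis
  proof
    show "compact (K i)" for i using K_cases[of i] compact by auto
    show "diameter (K i) \<le> \<delta>" for i using K_cases[of i] small \<open>\<delta> > 0\<close> by auto
    show "S \<subseteq> (\<Union>i. K i)"
    proof
      fix x assume "x \<in> S"
      then obtain Q where "Q \<in> \<D>" "x \<in> Q" using cover by blast
      then have "K (to_nat_on \<D> Q) = Q" using \<open>countable \<D>\<close> by (simp add: K_def)
      then show "x \<in> (\<Union>i. K i)" using \<open>x \<in> Q\<close> by blast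
    qed
    have "ennreal (diameter (K i) ^ ?n) \<le> ennreal (real ?n ^ ?n) * emeasure lborel (interior (K i))" for i
      using K_cases[of i] vol by auto
    then have "(\<Sum>i. ennreal (diameter (K i) ^ ?n)) \<le>
        (\<Sum>i. ennreal (real ?n ^ ?n) * emeasure lborel (interior (K i)))"
      by (intro suminf_le) auto
    also have "\<dots> \<le> ennreal (real ?n ^ ?n) * ennreal (2 * \<epsilon>)"
      using total by (simp add: mult_left_mono)
    also have "\<dots> = ennreal (2 * real ?n ^ ?n * \<epsilon>)"
      using \<open>\<epsilon> > 0\<close> by (simp add: mult_ac flip: ennreal_mult)
    finally show "(\<Sum>i. ennreal (diameter (K i) ^ ?n)) \<le> ennreal (2 * real ?n ^ ?n * \<epsilon>)" .
  qed
qed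

lemma emeasure_norm_image_le_diameter:
  fixes K :: "'a::euclidean_space set"
  assumes "compact K"
  shows "emeasure lborel (norm ` K) \<le> ennreal (diameter K)"
proof (cases "K = {}")
  case False
  obtain x0 where x0: "x0 \<in> K" "\<And>x. x \<in> K \<Longrightarrow> norm x0 \<le> norm x"
    using continuous_attains_inf[OF assms False, of norm] by (auto intro: continuous_intros)
  have "norm x \<le> norm x0 + diameter K" if "x \<in> K" for x
    using diameter_bounded_bound[OF compact_imp_bounded[OF assms] that x0(1)]
      norm_triangle_ineq2[of x x0] by (simp add: dist_norm)
  then have "norm ` K \<subseteq> {norm x0..norm x0 + diameter K}" using x0 by auto
  then have "emeasure lborel (norm ` K) \<le> emeasure lborel {norm x0..norm x0 + diameter K}"
    by (intro emeasure_mono) auto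
  also have "\<dots> = ennreal (diameter K)"
    using diameter_ge_0[OF compact_imp_bounded[OF assms]] by simp
  finally show ?thesis .
qed simp

text \<open>
  The set \<open>\<sigma>\<close> need not be measurable, so its size is only available through the Borel sets \<open>B\<close> that
  contain the truncated cone \<open>C\<close> over it. If some \<open>B\<close> had very small measure, then \<open>C\<close> would be
  covered by cubes \<open>K i\<close> with small \<open>\<Sum> diameter (K i) ^ n\<close>. A cube meets the sphere of radius \<open>r\<close>
  only for \<open>r\<close> in a set of length at most its diameter, so the sum of \<open>diameter (K i) ^ (n - 1)\<close>
  over the cubes meeting that sphere is small on average over \<open>r \<in> {1..2}\<close>, hence for some \<open>r\<close>.
  Shrinking the traces of these cubes on the sphere back to the unit sphere covers \<open>\<sigma>\<close> cheaply,
  against the positivity of its Hausdorff measure. For \<open>n = 1\<close> the sum counts cubes, so that a sum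
  below 1 means that \<open>\<sigma>\<close> is empty.
\<close>

lemma cone_outer_measure_positive:
  fixes \<sigma> :: "'a::euclidean_space set"
  assumes \<sigma>: "\<sigma> \<subseteq> sphere 0 1" and pos: "hausdorff_measure (DIM('a) - 1) \<sigma> > 0"
  obtains m where "m > 0"
    "\<And>B. B \<in> sets borel \<Longrightarrow> (\<And>r \<omega>. r \<in> {1..2} \<Longrightarrow> \<omega> \<in> \<sigma> \<Longrightarrow> r *\<^sub>R \<omega> \<in> B) \<Longrightarrow>
      ennreal m \<le> emeasure lborel B"
proof -
  let ?n = "DIM('a)"
  let ?d = "DIM('a) - 1"
  obtain \<delta> where "\<delta> > 0" and \<delta>: "0 < (INF U \<in> {U :: nat \<Rightarrow> 'a set. \<sigma> \<subseteq> (\<Union>i. U i) \<and>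
      (\<forall>i. bounded (U i) \<and> diameter (U i) \<le> \<delta>)}. (\<Sum>i. hausdorff_weight ?d (U i)))"
    using pos unfolding hausdorff_measure_def less_SUP_iff by auto
  define I where "I = (INF U \<in> {U :: nat \<Rightarrow> 'a set. \<sigma> \<subseteq> (\<Union>i. U i) \<and>
      (\<forall>i. bounded (U i) \<and> diameter (U i) \<le> \<delta>)}. (\<Sum>i. hausdorff_weight ?d (U i)))"
  obtain \<eta> where "\<eta> > 0" and \<eta>: "ennreal \<eta> < I"
  proof -
    obtain e where "0 < e" "e < I" using dense[OF \<delta>] by (auto simp: I_def)
    moreover from this have "e < \<infinity>" by (metis infinity_ennreal_def less_le_trans top_greatest)
    ultimately show ?thesis using that[of "enn2real e"] by (auto simp: enn2real_positive_iff)
  qed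
  define v where "v = unit_ball_vol (real ?d)"
  have "v > 0" by (simp add: v_def)
  \<comment> \<open>Coverings below have \<open>\<Sum> diameter (K i) ^ n \<le> 2 * n ^ n * m = \<eta> / (2 * v)\<close>,
    strictly below the threshold \<open>\<eta> / v\<close> at which the covering of \<open>\<sigma>\<close> would cost as much as \<open>\<eta>\<close>.\<close>
  define m where "m = \<eta> / (4 * real ?n ^ ?n * v)"
  have "m > 0" using \<open>\<eta> > 0\<close> \<open>v > 0\<close> by (simp add: m_def)
  have "ennreal m \<le> emeasure lborel B"
    if B: "B \<in> sets borel" "\<And>r \<omega>. r \<in> {1..2} \<Longrightarrow> \<omega> \<in> \<sigma> \<Longrightarrow> r *\<^sub>R \<omega> \<in> B" for B
  proof (rule ccontr)
    assume "\<not> ennreal m \<le> emeasure lborel B"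
    then have B_small: "emeasure lborel B < ennreal m" by simp
    define C where "C = {r *\<^sub>R \<omega> | r \<omega>. r \<in> {1..2} \<and> \<omega> \<in> \<sigma>}"
    have "C \<subseteq> B" using B(2) by (auto simp: C_def)
    have "norm x \<le> 2" if "x \<in> C" for x
      using that \<sigma> by (auto simp: C_def subset_iff)
    then have "bounded C" unfolding bounded_iff by blast
    obtain K :: "nat \<Rightarrow> 'a set" where compact: "\<And>i. compact (K i)" and cover: "C \<subseteq> (\<Union>i. K i)"
      and small: "\<And>i. diameter (K i) \<le> \<delta>"
      and total: "(\<Sum>i. ennreal (diameter (K i) ^ ?n)) \<le> ennreal (2 * real ?n ^ ?n * m)"
      using cover_by_small_cubes[OF \<open>bounded C\<close> \<open>C \<subseteq> B\<close> B(1) B_small \<open>m > 0\<close> \<open>\<delta> > 0\<close>] by metis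
    have diam0: "diameter (K i) \<ge> 0" for i
      by (intro diameter_ge_0 compact_imp_bounded compact)
    define cost where
      "cost r = (\<Sum>i. indicator (norm ` K i) r * ennreal (diameter (K i) ^ ?d))" for r :: real
    have [measurable]: "norm ` K i \<in> sets borel" for i
      by (intro borel_compact compact_continuous_image compact continuous_intros)
    have "(\<integral>\<^sup>+r. cost r \<partial>lborel) =
        (\<Sum>i. emeasure lborel (norm ` K i) * ennreal (diameter (K i) ^ ?d))"
      unfolding cost_def by (simp add: nn_integral_suminf nn_integral_multc)
    also have "\<dots> \<le> (\<Sum>i. ennreal (diameter (K i) ^ ?n))"
    proof (intro suminf_le)
      fix i
      have "emeasure lborel (norm ` K i) * ennreal (diameter (K i) ^ ?d) \<le>
          ennreal (diameter (K i)) * ennreal (diameter (K i) ^ ?d)"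
        by (intro mult_right_mono emeasure_norm_image_le_diameter compact) simp
      also have "\<dots> = ennreal (diameter (K i) ^ ?n)"
        using diam0[of i] DIM_positive[where 'a='a]
        by (cases ?n) (simp_all flip: ennreal_mult)
      finally show "emeasure lborel (norm ` K i) * ennreal (diameter (K i) ^ ?d) \<le>
          ennreal (diameter (K i) ^ ?n)" .
    qed auto
    also have "\<dots> \<le> ennreal (\<eta> / (2 * v))"
      using total by (simp add: m_def)
    also have "\<dots> < ennreal (\<eta> / v)"
      using \<open>\<eta> > 0\<close> \<open>v > 0\<close> by (intro ennreal_lessI) (auto simp: field_simps)
    finally have mean: "(\<integral>\<^sup>+r. cost r \<partial>lborel) < ennreal (\<eta> / v)" .
    obtain r where r: "r \<in> {1..2}" "cost r < ennreal (\<eta> / v)"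
    proof (rule ccontr)
      assume "\<not> thesis"
      then have "ennreal (\<eta> / v) \<le> cost r" if "r \<in> {1..2}" for r
        using that \<open>\<not> thesis\<close> \<open>\<And>r. r \<in> {1..2} \<Longrightarrow> cost r < ennreal (\<eta> / v) \<Longrightarrow> thesis\<close>
        by (meson not_le)
      then have "(\<integral>\<^sup>+r. ennreal (\<eta> / v) * indicator {1..2::real} r \<partial>lborel) \<le> (\<integral>\<^sup>+r. cost r \<partial>lborel)"
        by (intro nn_integral_mono) (auto simp: indicator_def)
      then show False using mean by (simp add: nn_integral_cmult_indicator)
    qed
    define U where "U i = {y \<in> sphere 0 1. r *\<^sub>R y \<in> K i}" for i
    have U: "bounded (U i)" "diameter (U i) \<le> diameter (K i)" for i
    proof -
      show "bounded (U i)" by (rule bounded_subset[of "sphere 0 1"]) (auto simp: U_def)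
      show "diameter (U i) \<le> diameter (K i)"
      proof (rule diameter_le)
        fix x y assume "x \<in> U i" "y \<in> U i"
        then have "dist (r *\<^sub>R x) (r *\<^sub>R y) \<le> diameter (K i)"
          by (intro diameter_bounded_bound compact_imp_bounded compact) (auto simp: U_def)
        then have "r * norm (x - y) \<le> diameter (K i)"
          using r(1) by (simp add: dist_norm flip: scaleR_diff_right)
        moreover have "1 * norm (x - y) \<le> r * norm (x - y)"
          using r(1) by (intro mult_right_mono) auto
        ultimately show "norm (x - y) \<le> diameter (K i)" by simp
      qed (simp add: diam0)
    qed
    have "\<sigma> \<subseteq> (\<Union>i. U i)"
    proof
      fix \<omega> assume "\<omega> \<in> \<sigma>"
      then have "r *\<^sub>R \<omega> \<in> C" using r(1) by (auto simp: C_def)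
      then show "\<omega> \<in> (\<Union>i. U i)" using cover \<open>\<omega> \<in> \<sigma>\<close> \<sigma> by (auto simp: U_def)
    qed
    then have "I \<le> (\<Sum>i. hausdorff_weight ?d (U i))"
      unfolding I_def using U(1) order_trans[OF U(2) small] by (intro INF_lower) auto
    also have "\<dots> \<le> (\<Sum>i. ennreal v * (indicator (norm ` K i) r * ennreal (diameter (K i) ^ ?d)))"
    proof (intro suminf_le)
      fix i
      show "hausdorff_weight ?d (U i) \<le>
          ennreal v * (indicator (norm ` K i) r * ennreal (diameter (K i) ^ ?d))"
      proof (cases "U i = {}")
        case False
        then obtain y where "norm y = 1" "r *\<^sub>R y \<in> K i" by (auto simp: U_def)
        then have "r \<in> norm ` K i" using r(1) by (auto intro!: image_eqI[of _ _ "r *\<^sub>R y"])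
        moreover have "(diameter (U i) / 2) ^ ?d \<le> diameter (K i) ^ ?d"
          using U(2)[of i] diameter_ge_0[OF U(1), of i] by (intro power_mono) auto
        ultimately have in_shadow: "r \<in> norm ` K i"
          and le: "(diameter (U i) / 2) ^ ?d \<le> diameter (K i) ^ ?d" by blast+
        have "hausdorff_weight ?d (U i) = ennreal (v * (diameter (U i) / 2) ^ ?d)"
          using False by (simp only: hausdorff_weight_def v_def if_False)
        also have "\<dots> \<le> ennreal (v * diameter (K i) ^ ?d)"
          using \<open>v > 0\<close> le by (intro ennreal_leI mult_left_mono) auto
        also have "\<dots> = ennreal v * (indicator (norm ` K i) r * ennreal (diameter (K i) ^ ?d))"
          using \<open>v > 0\<close> diam0[of i] in_shadow by (simp add: ennreal_mult)
        finally show ?thesis .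
      qed (simp add: hausdorff_weight_def)
    qed auto
    also have "\<dots> = ennreal v * cost r" by (simp add: cost_def)
    also have "\<dots> \<le> ennreal v * ennreal (\<eta> / v)" using r(2) by (intro mult_left_mono) auto
    also have "\<dots> = ennreal \<eta>" using \<open>v > 0\<close> \<open>\<eta> > 0\<close> by (simp flip: ennreal_mult)
    finally show False using \<eta> by simp
  qed
  then show ?thesis using that \<open>m > 0\<close> by blast
qed

section \<open>The quotient defining the Poincare constant\<close>

lemma L2_energy_ne_0:
  assumes [measurable]: "u \<in> borel_measurable borel" and vanish: "\<And>x. x \<notin> \<Omega> \<Longrightarrow> u x = 0"
    and "\<not> (AE x in lborel. u x = 0)"
  shows "L2_energy \<Omega> u \<noteq> 0"
  unfolding L2_energy_eq[of \<Omega> u, OF vanish, simplified]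
  using assms(3) by (subst nn_integral_0_iff_AE) auto

lemma P2_positiveI:
  assumes "c > 0" and bound: "\<And>u. u \<in> Hs_space s \<Omega> \<Longrightarrow> c * L2_energy \<Omega> u \<le> gagliardo_energy s u"
  shows "P2 s \<Omega> > 0"
proof -
  have "c \<le> gagliardo_energy s u / L2_energy \<Omega> u"
    if u: "u \<in> Hs_space s \<Omega>" "\<not> (AE x in lborel. u x = 0)" for u
  proof -
    have "u \<in> Hs_ambient s \<Omega>" using u by (simp add: Hs_space_def)
    then have fin: "L2_energy \<Omega> u \<noteq> top" by (auto simp: Hs_ambient_def)
    have ne: "L2_energy \<Omega> u \<noteq> 0"
      using \<open>u \<in> Hs_ambient s \<Omega>\<close> u(2) by (intro L2_energy_ne_0) (auto simp: Hs_ambient_def)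
    have "c = c * L2_energy \<Omega> u / L2_energy \<Omega> u"
      using fin ne by (simp add: ennreal_mult_divide_eq)
    also have "\<dots> \<le> gagliardo_energy s u / L2_energy \<Omega> u"
      by (intro divide_right_mono_ennreal bound u(1))
    finally show ?thesis .
  qed
  then have "c \<le> P2 s \<Omega>" unfolding P2_def by (intro INF_greatest) auto
  with \<open>c > 0\<close> show ?thesis by (rule less_le_trans)
qed

lemma P2_times_L2_energy_le:
  assumes u: "u \<in> Hs_space s \<Omega>"
  shows "P2 s \<Omega> * L2_energy \<Omega> u \<le> gagliardo_energy s u"
proof (cases "AE x in lborel. u x = 0")
  case True
  then have "L2_energy \<Omega> u = (\<integral>\<^sup>+x. 0 \<partial>(lborel :: 'a measure))"
    unfolding L2_energy_def by (intro nn_integral_cong_AE) auto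
  then show ?thesis by simp
next
  case False
  have amb: "u \<in> Hs_ambient s \<Omega>" using u by (simp add: Hs_space_def)
  then have fin: "L2_energy \<Omega> u \<noteq> top" by (auto simp: Hs_ambient_def)
  have ne: "L2_energy \<Omega> u \<noteq> 0"
    using amb False by (intro L2_energy_ne_0) (auto simp: Hs_ambient_def)
  have "P2 s \<Omega> * L2_energy \<Omega> u \<le> gagliardo_energy s u / L2_energy \<Omega> u * L2_energy \<Omega> u"
    unfolding P2_def using u False by (intro mult_right_mono INF_lower) auto
  also have "\<dots> = gagliardo_energy s u"
    using fin ne by (simp add: ennreal_divide_times ennreal_divide_self top.not_eq_extremum)
  finally show ?thesis .
qed

section \<open>Domains with a uniformly thick complement\<close>

text \<open>
  For \<open>y \<in> \<Omega>\<close>, the inner integral is at least its part over the points \<open>x\<close> of the complement in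
  \<open>ball y R\<close>, where \<open>u x - u y = - u y\<close> and the kernel is at least \<open>1 / R powr (n + 2 * s)\<close>.
\<close>

lemma gagliardo_energy_ge_complement:
  fixes u :: "'a::euclidean_space \<Rightarrow> real"
  assumes "open \<Omega>" "s > 0" "R > 0" "c > 0"
    and dense: "\<And>x. x \<in> \<Omega> \<Longrightarrow> c < measure lborel (- \<Omega> \<inter> ball x R)"
    and [measurable]: "u \<in> borel_measurable borel" and vanish: "\<And>x. x \<notin> \<Omega> \<Longrightarrow> u x = 0"
  shows "ennreal (c / R powr (real DIM('a) + 2 * s)) * L2_energy \<Omega> u \<le> gagliardo_energy s u"
proof -
  define p where "p = real DIM('a) + 2 * s"
  have "p > 0" using \<open>s > 0\<close> by (simp add: p_def)
  have [measurable]: "\<Omega> \<in> sets borel" using \<open>open \<Omega>\<close> by simp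
  have pointwise: "ennreal (c / R powr p) * ennreal ((u y)\<^sup>2) \<le>
      (\<integral>\<^sup>+x. ennreal ((u x - u y)\<^sup>2 / norm (x - y) powr p) \<partial>lborel)" for y
  proof (cases "y \<in> \<Omega>")
    case True
    let ?E = "- \<Omega> \<inter> ball y R"
    have "emeasure lborel ?E < \<infinity>"
      by (intro emeasure_bounded_finite) (rule bounded_subset[of "ball y R"], auto)
    then have "ennreal c \<le> emeasure lborel ?E"
      using dense[OF True] by (simp add: emeasure_eq_ennreal_measure ennreal_leI)
    have "ennreal (c / R powr p) * ennreal ((u y)\<^sup>2) = ennreal ((u y)\<^sup>2 / R powr p) * ennreal c"
      using \<open>c > 0\<close> by (simp add: mult.commute flip: ennreal_mult)
    also have "\<dots> \<le> ennreal ((u y)\<^sup>2 / R powr p) * emeasure lborel ?E"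
      by (intro mult_left_mono) (use \<open>ennreal c \<le> _\<close> in auto)
    also have "\<dots> = (\<integral>\<^sup>+x. ennreal ((u y)\<^sup>2 / R powr p) * indicator ?E x \<partial>lborel)"
      by (rule nn_integral_cmult_indicator[symmetric]) measurable
    also have "\<dots> \<le> (\<integral>\<^sup>+x. ennreal ((u x - u y)\<^sup>2 / norm (x - y) powr p) \<partial>lborel)"
    proof (rule nn_integral_mono)
      fix x
      show "ennreal ((u y)\<^sup>2 / R powr p) * indicator ?E x \<le>
          ennreal ((u x - u y)\<^sup>2 / norm (x - y) powr p)"
      proof (cases "x \<in> ?E")
        case x: True
        then have "x \<noteq> y" "norm (x - y) < R" using True by (auto simp: dist_norm norm_minus_commute)
        then have "0 < norm (x - y) powr p" "norm (x - y) powr p \<le> R powr p"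
          using \<open>p > 0\<close> by (auto intro!: powr_mono2)
        then have "(u y)\<^sup>2 / R powr p \<le> (u y)\<^sup>2 / norm (x - y) powr p"
          using \<open>R > 0\<close> by (intro divide_left_mono mult_pos_pos) auto
        moreover have "u x = 0" using x vanish by auto
        ultimately show ?thesis using x by (simp add: ennreal_leI)
      qed simp
    qed
    finally show ?thesis .
  qed (simp add: vanish)
  have "ennreal (c / R powr p) * L2_energy \<Omega> u =
      (\<integral>\<^sup>+y. ennreal (c / R powr p) * ennreal ((u y)\<^sup>2) \<partial>lborel)"
    using vanish by (subst L2_energy_eq) (auto simp: nn_integral_cmult)
  also have "\<dots> \<le> gagliardo_energy s u"
    unfolding gagliardo_energy_def p_def[symmetric] by (intro nn_integral_mono pointwise)
  finally show ?thesis by (simp add: p_def)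
qed

section \<open>Domains controlled by their one-dimensional sections\<close>

text \<open>
  The restriction of a test function to a line is a test function for the section of \<open>\<Omega>\<close> by that
  line, so the one-dimensional inequality applies on every line; averaging over the slab gives the
  claim.
\<close>

lemma directional_energy_ge_sections:
  fixes \<phi> :: "'a::euclidean_space \<Rightarrow> real"
  assumes \<phi>: "\<phi> \<in> Cc_infinity \<Omega>" and s: "0 < s" "s < 1" and \<omega>: "norm \<omega> = 1"
    and sections: "\<And>x. l \<le> P2 s (line_section \<Omega> x \<omega>)"
  shows "l * L2_energy \<Omega> \<phi> \<le> directional_energy s \<phi> \<omega>"
proof -
  have [measurable]: "\<phi> \<in> borel_measurable borel" by (rule borel_measurable_Cc_infinity[OF \<phi>])
  define slab :: "'a \<Rightarrow> ennreal" where "slab = indicator {x. x \<bullet> \<omega> \<in> {0..<1}}"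
  have [measurable]: "slab \<in> borel_measurable borel" unfolding slab_def by measurable
  have section_bound: "l * (\<integral>\<^sup>+\<tau>. ennreal ((\<phi> (x + \<tau> *\<^sub>R \<omega>))\<^sup>2) \<partial>lborel) \<le>
      gagliardo_energy s (\<lambda>\<tau>. \<phi> (x + \<tau> *\<^sub>R \<omega>))" for x
  proof -
    have line: "(\<lambda>\<tau>. \<phi> (x + \<tau> *\<^sub>R \<omega>)) \<in> Cc_infinity (line_section \<Omega> x \<omega>)"
      by (rule Cc_infinity_along_line[OF \<phi> \<omega>])
    have "l * (\<integral>\<^sup>+\<tau>. ennreal ((\<phi> (x + \<tau> *\<^sub>R \<omega>))\<^sup>2) \<partial>lborel) =
        l * L2_energy (line_section \<Omega> x \<omega>) (\<lambda>\<tau>. \<phi> (x + \<tau> *\<^sub>R \<omega>))"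
      by (subst L2_energy_eq) (auto dest: Cc_infinity_eq_0_outside[OF line])
    also have "\<dots> \<le> P2 s (line_section \<Omega> x \<omega>) *
        L2_energy (line_section \<Omega> x \<omega>) (\<lambda>\<tau>. \<phi> (x + \<tau> *\<^sub>R \<omega>))"
      by (intro mult_right_mono sections) simp
    also have "\<dots> \<le> gagliardo_energy s (\<lambda>\<tau>. \<phi> (x + \<tau> *\<^sub>R \<omega>))"
      by (intro P2_times_L2_energy_le Cc_infinity_subset_Hs_space[OF line] s)
    finally show ?thesis .
  qed
  have "l * L2_energy \<Omega> \<phi> = l * (\<integral>\<^sup>+x. ennreal ((\<phi> x)\<^sup>2) \<partial>lborel)"
    by (subst L2_energy_eq) (auto dest: Cc_infinity_eq_0_outside[OF \<phi>])
  also have "\<dots> = l * (\<integral>\<^sup>+x. slab x * (\<integral>\<^sup>+\<tau>. ennreal ((\<phi> (x + \<tau> *\<^sub>R \<omega>))\<^sup>2) \<partial>lborel) \<partial>lborel)"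
    unfolding slab_def by (subst nn_integral_over_parallel_lines[OF _ \<omega>]) simp_all
  also have "\<dots> = (\<integral>\<^sup>+x. slab x * (l * (\<integral>\<^sup>+\<tau>. ennreal ((\<phi> (x + \<tau> *\<^sub>R \<omega>))\<^sup>2) \<partial>lborel)) \<partial>lborel)"
    by (subst nn_integral_cmult[symmetric]) (simp_all add: mult.left_commute)
  also have "\<dots> \<le> (\<integral>\<^sup>+x. slab x * gagliardo_energy s (\<lambda>\<tau>. \<phi> (x + \<tau> *\<^sub>R \<omega>)) \<partial>lborel)"
    by (intro nn_integral_mono mult_left_mono section_bound) simp
  also have "\<dots> = directional_energy s \<phi> \<omega>"
    unfolding slab_def by (rule directional_energy_over_lines[symmetric, OF _ \<omega>]) measurable
  finally show ?thesis .
qed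

text \<open>
  The directional bound holds for all directions in \<open>\<sigma>\<close>, hence, by homogeneity, on the truncated cone
  over \<open>\<sigma>\<close>. For each \<open>\<phi>\<close> the set \<open>G\<close> of all \<open>k\<close> in the shell with that bound is Borel and contains
  the cone, so its measure is at least a constant that depends on \<open>\<sigma>\<close> alone.
\<close>

lemma LS_type_energy_bound:
  fixes \<Omega> :: "'a::euclidean_space set"
  assumes LS: "LS_type s \<Omega>" and s: "0 < s" "s < 1"
  obtains c where "c > 0" "\<And>\<phi>. \<phi> \<in> Cc_infinity \<Omega> \<Longrightarrow> ennreal c * L2_energy \<Omega> \<phi> \<le> gagliardo_energy s \<phi>"
proof -
  obtain \<sigma> where \<sigma>: "\<sigma> \<subseteq> sphere 0 1" and pos: "hausdorff_measure (DIM('a) - 1) \<sigma> > 0"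
    and unif: "uniform_FP s (UNIV \<times> \<sigma>) (\<lambda>(x0, \<omega>). line_section \<Omega> x0 \<omega>)"
    using LS by (auto simp: LS_type_def)
  obtain l where "l > 0" and l: "\<And>x \<omega>. \<omega> \<in> \<sigma> \<Longrightarrow> ennreal l \<le> P2 s (line_section \<Omega> x \<omega>)"
  proof -
    define L where "L = (INF \<alpha>\<in>UNIV \<times> \<sigma>. P2 s ((\<lambda>(x0, \<omega>). line_section \<Omega> x0 \<omega>) \<alpha>))"
    have "L > 0" using unif by (simp add: uniform_FP_def L_def)
    have "L \<le> P2 s (line_section \<Omega> x \<omega>)" if "\<omega> \<in> \<sigma>" for x \<omega>
      unfolding L_def using that by (intro INF_lower2[of "(x, \<omega>)"]) auto
    \<comment> \<open>The minimum with 1 gives a real number without a separate argument that \<open>L\<close> is finite.\<close>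
    moreover have "ennreal (enn2real (min 1 L)) = min 1 L"
      by (simp add: min_less_iff_disj)
    moreover have "enn2real (min 1 L) > 0"
      using \<open>L > 0\<close> by (simp add: enn2real_positive_iff min_less_iff_disj)
    ultimately show ?thesis
      using that[of "enn2real (min 1 L)"] by (simp add: min.coboundedI2)
  qed
  obtain m where "m > 0" and m: "\<And>B. B \<in> sets borel \<Longrightarrow>
      (\<And>r \<omega>. r \<in> {1..2} \<Longrightarrow> \<omega> \<in> \<sigma> \<Longrightarrow> r *\<^sub>R \<omega> \<in> B) \<Longrightarrow> ennreal m \<le> emeasure lborel B"
    using cone_outer_measure_positive[OF \<sigma> pos] by metis
  obtain \<kappa> where "\<kappa> > 0" and \<kappa>: "shell_constant TYPE('a) s = ennreal \<kappa>"
    using shell_constant_finite[OF s(1), where 'a='a] shell_constant_positive[OF s(1), where 'a='a]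
    by (cases "shell_constant TYPE('a) s") auto
  define c where "c = l * m / \<kappa>"
  have "c > 0" using \<open>l > 0\<close> \<open>m > 0\<close> \<open>\<kappa> > 0\<close> by (simp add: c_def)
  moreover have "ennreal c * L2_energy \<Omega> \<phi> \<le> gagliardo_energy s \<phi>" if \<phi>: "\<phi> \<in> Cc_infinity \<Omega>" for \<phi>
  proof -
    have [measurable]: "\<phi> \<in> borel_measurable borel" by (rule borel_measurable_Cc_infinity[OF \<phi>])
    define b where "b = ennreal l * L2_energy \<Omega> \<phi>"
    define G where "G = {k :: 'a. norm k \<in> {1..2} \<and> b \<le> directional_energy s \<phi> k}"
    have [measurable]: "G \<in> sets borel" unfolding G_def by measurable
    have "r *\<^sub>R \<omega> \<in> G" if r: "r \<in> {1..2}" and "\<omega> \<in> \<sigma>" for r \<omega>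
    proof -
      have \<omega>: "norm \<omega> = 1" using \<open>\<omega> \<in> \<sigma>\<close> \<sigma> by auto
      have "b \<le> directional_energy s \<phi> \<omega>"
        unfolding b_def using l[OF \<open>\<omega> \<in> \<sigma>\<close>] by (intro directional_energy_ge_sections \<phi> s \<omega>)
      also have "\<dots> = 1 * directional_energy s \<phi> \<omega>" by simp
      also have "\<dots> \<le> ennreal (r powr (2 * s)) * directional_energy s \<phi> \<omega>"
        using r s by (intro mult_right_mono) (auto intro!: ge_one_powr_ge_zero)
      also have "\<dots> = directional_energy s \<phi> (r *\<^sub>R \<omega>)"
        using r by (subst directional_energy_scaleR) auto
      finally show ?thesis using r \<omega> by (simp add: G_def)
    qed
    then have "ennreal m \<le> emeasure lborel G" by (intro m) auto
    then have "b * ennreal m \<le> b * emeasure lborel G" by (intro mult_left_mono) auto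
    also have "\<dots> = (\<integral>\<^sup>+k. b * indicator G k \<partial>lborel)"
      by (rule nn_integral_cmult_indicator[symmetric]) measurable
    also have "\<dots> \<le> (\<integral>\<^sup>+k. indicator {1..2} (norm k) * directional_energy s \<phi> k \<partial>lborel)"
      by (intro nn_integral_mono) (auto simp: G_def indicator_def)
    also have "\<dots> = ennreal \<kappa> * gagliardo_energy s \<phi>"
      unfolding \<kappa>[symmetric] by (rule shell_integral_directional_energy) measurable
    finally have "ennreal (1 / \<kappa>) * (b * ennreal m) \<le> ennreal (1 / \<kappa>) * (ennreal \<kappa> * gagliardo_energy s \<phi>)"
      by (intro mult_left_mono) auto
    also have "\<dots> = gagliardo_energy s \<phi>"
      using \<open>\<kappa> > 0\<close> by (simp flip: ennreal_mult mult.assoc)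
    also have "ennreal (1 / \<kappa>) * (b * ennreal m) = ennreal c * L2_energy \<Omega> \<phi>"
    proof -
      have "ennreal c = ennreal (1 / \<kappa>) * ennreal l * ennreal m"
        using \<open>l > 0\<close> \<open>m > 0\<close> \<open>\<kappa> > 0\<close> by (simp add: c_def flip: ennreal_mult)
      then show ?thesis by (simp add: b_def mult_ac)
    qed
    finally show ?thesis .
  qed
  ultimately show ?thesis using that by blast
qed

lemma power2_diff_le: "(a - b :: real)\<^sup>2 \<le> 2 * a\<^sup>2 + 2 * b\<^sup>2"
  using zero_le_power2[of "a + b"] by (simp add: power2_diff power2_sum)

lemma ennreal_le_double_sum:
  assumes "a \<le> 2 * b + 2 * c" "b \<ge> 0" "c \<ge> 0"
  shows "ennreal a \<le> 2 * ennreal b + 2 * ennreal c"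
  using ennreal_leI[OF assms(1)] assms(2,3) by (simp add: ennreal_mult'')

lemma gagliardo_energy_diff_le:
  fixes f g :: "'a::euclidean_space \<Rightarrow> real"
  assumes [measurable]: "f \<in> borel_measurable borel" "g \<in> borel_measurable borel"
  shows "gagliardo_energy s (\<lambda>x. f x - g x) \<le> 2 * gagliardo_energy s f + 2 * gagliardo_energy s g"
proof -
  let ?q = "\<lambda>u x y. ennreal ((u x - u y)\<^sup>2 / norm (x - y) powr (real DIM('a) + 2 * s))"
  have "?q (\<lambda>x. f x - g x) x y \<le> 2 * ?q f x y + 2 * ?q g x y" for x y
  proof -
    have "((f x - g x) - (f y - g y))\<^sup>2 \<le> 2 * (f x - f y)\<^sup>2 + 2 * (g x - g y)\<^sup>2"
      using power2_diff_le[of "f x - f y" "g x - g y"] by (simp add: algebra_simps)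
    then have "((f x - g x) - (f y - g y))\<^sup>2 / norm (x - y) powr (real DIM('a) + 2 * s) \<le>
        2 * ((f x - f y)\<^sup>2 / norm (x - y) powr (real DIM('a) + 2 * s)) +
        2 * ((g x - g y)\<^sup>2 / norm (x - y) powr (real DIM('a) + 2 * s))"
      by (simp add: divide_right_mono flip: add_divide_distrib)
    then show ?thesis by (intro ennreal_le_double_sum) auto
  qed
  then have "gagliardo_energy s (\<lambda>x. f x - g x) \<le>
      (\<integral>\<^sup>+y. (\<integral>\<^sup>+x. 2 * ?q f x y + 2 * ?q g x y \<partial>lborel) \<partial>lborel)"
    unfolding gagliardo_energy_def by (intro nn_integral_mono)
  also have "\<dots> = (\<integral>\<^sup>+y. 2 * (\<integral>\<^sup>+x. ?q f x y \<partial>lborel) + 2 * (\<integral>\<^sup>+x. ?q g x y \<partial>lborel) \<partial>lborel)"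
    by (simp add: nn_integral_add nn_integral_cmult)
  also have "\<dots> = 2 * gagliardo_energy s f + 2 * gagliardo_energy s g"
    unfolding gagliardo_energy_def by (simp add: nn_integral_add nn_integral_cmult)
  finally show ?thesis .
qed

lemma L2_energy_diff_le:
  fixes f g :: "'a::euclidean_space \<Rightarrow> real"
  assumes [measurable]: "f \<in> borel_measurable borel" "g \<in> borel_measurable borel" "\<Omega> \<in> sets borel"
  shows "L2_energy \<Omega> (\<lambda>x. f x - g x) \<le> 2 * L2_energy \<Omega> f + 2 * L2_energy \<Omega> g"
proof -
  have "ennreal ((f x - g x)\<^sup>2) \<le> 2 * ennreal ((f x)\<^sup>2) + 2 * ennreal ((g x)\<^sup>2)" for x
    by (intro ennreal_le_double_sum power2_diff_le) auto
  then have "L2_energy \<Omega> (\<lambda>x. f x - g x) \<le>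
      (\<integral>\<^sup>+x. 2 * (ennreal ((f x)\<^sup>2) * indicator \<Omega> x) + 2 * (ennreal ((g x)\<^sup>2) * indicator \<Omega> x) \<partial>lborel)"
    unfolding L2_energy_def by (intro nn_integral_mono) (auto simp: indicator_def)
  also have "\<dots> = 2 * L2_energy \<Omega> f + 2 * L2_energy \<Omega> g"
    unfolding L2_energy_def by (simp add: nn_integral_add nn_integral_cmult)
  finally show ?thesis .
qed

text \<open>
  The factor 4 comes from using \<open>(a - b)\<^sup>2 \<le> 2 * a\<^sup>2 + 2 * b\<^sup>2\<close> twice in place of the triangle inequality
  for the two seminorms; it does not affect positivity of the constant.
\<close>

lemma energy_bound_extends_to_Hs_space:
  fixes \<Omega> :: "'a::euclidean_space set"
  assumes "open \<Omega>" and s: "0 < s" "s < 1" and "c > 0"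
    and bound: "\<And>\<phi>. \<phi> \<in> Cc_infinity \<Omega> \<Longrightarrow> ennreal c * L2_energy \<Omega> \<phi> \<le> gagliardo_energy s \<phi>"
    and u: "u \<in> Hs_space s \<Omega>"
  shows "ennreal c * L2_energy \<Omega> u \<le> 4 * gagliardo_energy s u"
proof (rule ennreal_le_epsilon)
  fix e :: real
  assume "e > 0"
  have [measurable]: "\<Omega> \<in> sets borel" using \<open>open \<Omega>\<close> by simp
  have amb: "u \<in> Hs_ambient s \<Omega>" using u by (simp add: Hs_space_def)
  then have [measurable]: "u \<in> borel_measurable borel" by (simp add: Hs_ambient_def)
  \<comment> \<open>This makes the accumulated errors below, \<open>4 * \<epsilon>\<^sup>2 + 2 * c * \<epsilon>\<^sup>2\<close>, equal to \<open>e\<close>.\<close>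
  define \<epsilon> where "\<epsilon> = sqrt (e / (4 + 2 * c))"
  have "\<epsilon> > 0" using \<open>e > 0\<close> \<open>c > 0\<close> by (simp add: \<epsilon>_def)
  have \<epsilon>: "(4 + 2 * c) * \<epsilon>\<^sup>2 = e" using \<open>e > 0\<close> \<open>c > 0\<close> by (simp add: \<epsilon>_def)
  obtain \<phi> where \<phi>: "\<phi> \<in> Cc_infinity \<Omega>" and close: "Hs_norm s \<Omega> (\<lambda>x. u x - \<phi> x) < \<epsilon>"
    using u \<open>\<epsilon> > 0\<close> by (auto simp: Hs_space_def)
  have [measurable]: "\<phi> \<in> borel_measurable borel" by (rule borel_measurable_Cc_infinity[OF \<phi>])
  define w where "w = (\<lambda>x. u x - \<phi> x)"
  have [measurable]: "w \<in> borel_measurable borel" unfolding w_def by measurable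
  \<comment> \<open>Only because both energies of \<open>\<phi>\<close> are finite does smallness of the real-valued norm bound
    the energies of \<open>w\<close>.\<close>
  have "gagliardo_energy s w < \<infinity>"
    using gagliardo_energy_diff_le[of u \<phi> s] gagliardo_energy_Cc_infinity_finite[OF \<phi> s] amb
    by (auto simp: w_def Hs_ambient_def ennreal_mult_less_top elim!: order.strict_trans1)
  moreover have "L2_energy \<Omega> w < \<infinity>"
    using L2_energy_diff_le[of u \<phi> \<Omega>] L2_energy_Cc_infinity_finite[OF \<phi>] amb
    by (auto simp: w_def Hs_ambient_def ennreal_mult_less_top elim!: order.strict_trans1)
  moreover have small: "x \<le> ennreal (\<epsilon>\<^sup>2)" if "x < \<infinity>" "sqrt (enn2real x) < \<epsilon>" for x
  proof -
    have "enn2real x < \<epsilon>\<^sup>2" using power_strict_mono[OF that(2), of 2] by simp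
    then show ?thesis using that(1) by (metis ennreal_enn2real ennreal_leI less_imp_le infinity_ennreal_def)
  qed
  moreover have "sqrt (enn2real (L2_energy \<Omega> w)) < \<epsilon>" "sqrt (enn2real (gagliardo_energy s w)) < \<epsilon>"
  proof -
    have "sqrt (enn2real (L2_energy \<Omega> w)) + sqrt (enn2real (gagliardo_energy s w)) < \<epsilon>"
      using close by (simp add: Hs_norm_def w_def)
    moreover have "0 \<le> sqrt (enn2real (L2_energy \<Omega> w))" "0 \<le> sqrt (enn2real (gagliardo_energy s w))"
      by simp_all
    ultimately show "sqrt (enn2real (L2_energy \<Omega> w)) < \<epsilon>" "sqrt (enn2real (gagliardo_energy s w)) < \<epsilon>"
      by linarith+
  qed
  ultimately have w: "L2_energy \<Omega> w \<le> ennreal (\<epsilon>\<^sup>2)" "gagliardo_energy s w \<le> ennreal (\<epsilon>\<^sup>2)"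
    by auto
  have "gagliardo_energy s \<phi> = gagliardo_energy s (\<lambda>x. u x - w x)"
    by (simp add: w_def)
  also have "\<dots> \<le> 2 * gagliardo_energy s u + 2 * gagliardo_energy s w"
    by (rule gagliardo_energy_diff_le) measurable
  also have "\<dots> \<le> 2 * gagliardo_energy s u + 2 * ennreal (\<epsilon>\<^sup>2)"
    by (intro add_mono mult_left_mono w) auto
  finally have energy_\<phi>: "gagliardo_energy s \<phi> \<le> 2 * gagliardo_energy s u + 2 * ennreal (\<epsilon>\<^sup>2)" .
  have "L2_energy \<Omega> u = L2_energy \<Omega> (\<lambda>x. \<phi> x - (- w x))"
    by (simp add: w_def)
  also have "\<dots> \<le> 2 * L2_energy \<Omega> \<phi> + 2 * L2_energy \<Omega> (\<lambda>x. - w x)"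
    by (rule L2_energy_diff_le) measurable
  also have "L2_energy \<Omega> (\<lambda>x. - w x) = L2_energy \<Omega> w"
    by (simp add: L2_energy_def)
  finally have "ennreal c * L2_energy \<Omega> u \<le> ennreal c * (2 * L2_energy \<Omega> \<phi> + 2 * L2_energy \<Omega> w)"
    by (rule mult_left_mono) simp
  also have "\<dots> = 2 * (ennreal c * L2_energy \<Omega> \<phi>) + 2 * ennreal c * L2_energy \<Omega> w"
    by (simp add: distrib_left mult_ac)
  also have "\<dots> \<le> 2 * gagliardo_energy s \<phi> + 2 * ennreal c * ennreal (\<epsilon>\<^sup>2)"
    by (intro add_mono mult_left_mono bound[OF \<phi>] w) auto
  also have "\<dots> \<le> 2 * (2 * gagliardo_energy s u + 2 * ennreal (\<epsilon>\<^sup>2)) + 2 * ennreal c * ennreal (\<epsilon>\<^sup>2)"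
    by (intro add_mono mult_left_mono energy_\<phi>) auto
  also have "\<dots> =
      4 * gagliardo_energy s u + (4 * ennreal (\<epsilon>\<^sup>2) + 2 * ennreal c * ennreal (\<epsilon>\<^sup>2))"
    by (simp add: distrib_left add.assoc flip: mult.assoc)
  also have "4 * ennreal (\<epsilon>\<^sup>2) + 2 * ennreal c * ennreal (\<epsilon>\<^sup>2) = ennreal (4 * \<epsilon>\<^sup>2 + 2 * c * \<epsilon>\<^sup>2)"
    using \<open>c > 0\<close> by (simp add: ennreal_mult'')
  also have "4 * \<epsilon>\<^sup>2 + 2 * c * \<epsilon>\<^sup>2 = e" using \<epsilon> by (simp add: distrib_right)
  finally show "ennreal c * L2_energy \<Omega> u \<le> 4 * gagliardo_energy s u + ennreal e" .
qed

section \<open>Positivity of the Poincare constant\<close>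

theorem theorem1p3:
  fixes \<Omega> :: "'a::euclidean_space set" and s :: real
  assumes "open \<Omega>" and "\<Omega> \<noteq> {}" and "0 < s" and "s < 1"
    and "(\<exists>R>0. \<exists>c>0. \<forall>x\<in>\<Omega>. measure lborel ((- \<Omega>) \<inter> ball x R) > c) \<or> LS_type s \<Omega>"
  shows "P2 s \<Omega> > 0"
  using assms(5)
proof
  assume "\<exists>R>0. \<exists>c>0. \<forall>x\<in>\<Omega>. measure lborel ((- \<Omega>) \<inter> ball x R) > c"
  then obtain R c where "R > 0" "c > 0"
    and dense: "\<And>x. x \<in> \<Omega> \<Longrightarrow> c < measure lborel (- \<Omega> \<inter> ball x R)" by blast
  show ?thesis
  proof (rule P2_positiveI)
    show "0 < ennreal (c / R powr (real DIM('a) + 2 * s))"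
      using \<open>R > 0\<close> \<open>c > 0\<close> by simp
    fix u assume "u \<in> Hs_space s \<Omega>"
    then have "u \<in> borel_measurable borel" "\<And>x. x \<notin> \<Omega> \<Longrightarrow> u x = 0"
      by (auto simp: Hs_space_def Hs_ambient_def)
    then show "ennreal (c / R powr (real DIM('a) + 2 * s)) * L2_energy \<Omega> u \<le> gagliardo_energy s u"
      using gagliardo_energy_ge_complement[OF assms(1,3) \<open>R > 0\<close> \<open>c > 0\<close> dense] by blast
  qed
next
  assume "LS_type s \<Omega>"
  then obtain c where "c > 0"
    and c: "\<And>\<phi>. \<phi> \<in> Cc_infinity \<Omega> \<Longrightarrow> ennreal c * L2_energy \<Omega> \<phi> \<le> gagliardo_energy s \<phi>"
    using LS_type_energy_bound[OF _ assms(3,4)] by metis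
  show ?thesis
  proof (rule P2_positiveI)
    show "0 < ennreal (c / 4)" using \<open>c > 0\<close> by simp
    fix u assume u: "u \<in> Hs_space s \<Omega>"
    have "ennreal (c / 4) * L2_energy \<Omega> u = ennreal (1 / 4) * (ennreal c * L2_energy \<Omega> u)"
      using \<open>c > 0\<close> by (simp flip: ennreal_mult mult.assoc)
    also have "\<dots> \<le> ennreal (1 / 4) * (4 * gagliardo_energy s u)"
      by (intro mult_left_mono energy_bound_extends_to_Hs_space[OF assms(1,3,4) \<open>c > 0\<close> c u]) auto
    also have "\<dots> = gagliardo_energy s u"
    proof -
      have "ennreal (1 / 4) * 4 = 1" using ennreal_mult[of "1 / 4" 4] by simp
      then show ?thesis by (metis mult.assoc mult_1)
    qed
    finally show "ennreal (c / 4) * L2_energy \<Omega> u \<le> gagliardo_energy s u" .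
  qed
qed

end
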